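(* Let $0<b<1<a$. Let $\{Y(t),t\ge 0\}$ be a real-valued semi-stable($a,b$) process and let $\{T(t),t\ge 0\}$ be a positive selfdecomposable process independent of $\{Y(t)\}$. Then the process $\{X(t),t\ge0\}$ with $\{X(t)\}\stackrel{d}{=}\{Y(T(t))\}$, subordinated to $\{Y(t)\}$ by the directing process $\{T(t)\}$, is a semi-selfdecomposable($b$) process.
   Context: A Levy process is a stochastically continuous process $\{X(t),t\ge 0\}$ with stationary independent additive increments and $X(0)=0$. A positive Levy process is one taking values in $[0,\infty)$. If $\{Y(t)\}$ is a Levy process with characteristic function $\exp\{-t\psi(u)\}$ and $\{T(t)\}$ is a positive Levy process independent of $\{Y(t)\}$ whose Laplace transform at time $t$ is $\varphi^t$, the process $\{X(t)\}\stackrel{d}{=}\{Y(T(t))\}$ is said to be subordinated to $\{Y(t)\}$ by the directing process $\{T(t)\}$; its characteristic function at time $t$ is $\{\varphi(\psi(u))\}^t$. Semi-stability is understood in the strict sense: for $0<b<1<a$ a characteristic function $f$ is semi-stable($a,b$) if it is infinitely divisible and $f(u)=\exp\{-\psi(u)\}$ with $\psi(u)=a\psi(bu)$ for all $u\in\mathbf{R}$. A distribution with characteristic function $f$ is selfdecomposable (SD) if for every $c\in(0,1)$ there is a characteristic function $f_c$ with $f(s)=f(cs)f_c(s)$ for all $s\in\mathbf{R}$ (for distributions on $[0,\infty)$, the same with Laplace transforms: $\varphi(s)=\varphi(cs)\varphi_c(s)$, $s>0$). For $b\in(0,1)$ it is semi-selfdecomposable($b$) if there is a characteristic function $f_o$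 with $f(s)=f(bs)f_o(s)$ for all $s\in\mathbf{R}$. A Levy process $\{X(t)\}$ is called a semi-stable($a,b$), SD, or semi-selfdecomposable($b$) process if the distribution of $X(1)$ is semi-stable($a,b$), SD, or semi-selfdecomposable($b$), respectively. *)

theory Defs
  imports "HOL-Probability.Probability"
begin

section \<open>Classes of distributions\<close>

definition characteristic_function :: "(real \<Rightarrow> complex) \<Rightarrow> bool" where
  "characteristic_function f \<longleftrightarrow> (\<exists>\<mu>. real_distribution \<mu> \<and> f = char \<mu>)"

definition infinitely_divisible :: "(real \<Rightarrow> complex) \<Rightarrow> bool" where
  "infinitely_divisible f \<longleftrightarrow>
     characteristic_function f \<and>
     (\<forall>n::nat. n \<ge> 1 \<longrightarrow> (\<exists>g. characteristic_function g \<and> (\<forall>u. f u = g u ^ n)))"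

text \<open>
  The exponent of an infinitely divisible characteristic function is its distinguished
  (continuous, vanishing at 0) negative logarithm. Without continuity it would be determined
  only up to a pointwise choice of multiples of \<open>2 * pi * \<i>\<close>.
\<close>

definition characteristic_exponent :: "(real \<Rightarrow> complex) \<Rightarrow> (real \<Rightarrow> complex) \<Rightarrow> bool" where
  "characteristic_exponent f \<psi> \<longleftrightarrow>
     continuous_on UNIV \<psi> \<and> \<psi> 0 = 0 \<and> (\<forall>u. f u = exp (- \<psi> u))"

definition semi_stable :: "real \<Rightarrow> real \<Rightarrow> (real \<Rightarrow> complex) \<Rightarrow> bool" where
  "semi_stable a b f \<longleftrightarrow>
     0 < b \<and> b < 1 \<and> 1 < a \<and> infinitely_divisible f \<and>
     (\<exists>\<psi>. characteristic_exponent f \<psi> \<and> (\<forall>u. \<psi> u = of_real a * \<psi> (b * u)))"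

definition semi_selfdecomposable :: "real \<Rightarrow> (real \<Rightarrow> complex) \<Rightarrow> bool" where
  "semi_selfdecomposable b f \<longleftrightarrow>
     0 < b \<and> b < 1 \<and> characteristic_function f \<and>
     (\<exists>f\<^sub>o. characteristic_function f\<^sub>o \<and> (\<forall>s. f s = f (b * s) * f\<^sub>o s))"

definition nonneg_distribution :: "real measure \<Rightarrow> bool" where
  "nonneg_distribution \<mu> \<longleftrightarrow> real_distribution \<mu> \<and> (AE x in \<mu>. 0 \<le> x)"

definition laplace_transform :: "real measure \<Rightarrow> real \<Rightarrow> real" where
  "laplace_transform \<mu> s = (LINT x|\<mu>. exp (- (s * x)))"

definition nonneg_selfdecomposable :: "real measure \<Rightarrow> bool" where
  "nonneg_selfdecomposable \<mu> \<longleftrightarrow>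
     nonneg_distribution \<mu> \<and>
     (\<forall>c. 0 < c \<and> c < 1 \<longrightarrow>
        (\<exists>\<nu>. nonneg_distribution \<nu> \<and>
             (\<forall>s>0. laplace_transform \<mu> s = laplace_transform \<mu> (c * s) * laplace_transform \<nu> s)))"


section \<open>Processes\<close>

text \<open>
  A process is a function of type \<open>real \<Rightarrow> 'w \<Rightarrow> real\<close>; only its values at times
  \<open>t \<ge> 0\<close> are meaningful.
\<close>

definition real_process :: "'w measure \<Rightarrow> (real \<Rightarrow> 'w \<Rightarrow> real) \<Rightarrow> bool" where
  "real_process M X \<longleftrightarrow> prob_space M \<and> (\<forall>t\<ge>0. X t \<in> borel_measurable M)"

definition stochastically_continuous :: "'w measure \<Rightarrow> (real \<Rightarrow> 'w \<Rightarrow> real) \<Rightarrow> bool" where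
  "stochastically_continuous M X \<longleftrightarrow>
     (\<forall>t\<ge>0. \<forall>\<epsilon>>0.
        ((\<lambda>s. measure M {\<omega> \<in> space M. \<bar>X s \<omega> - X t \<omega>\<bar> > \<epsilon>}) \<longlongrightarrow> 0) (at t within {0..}))"

definition stationary_increments :: "'w measure \<Rightarrow> (real \<Rightarrow> 'w \<Rightarrow> real) \<Rightarrow> bool" where
  "stationary_increments M X \<longleftrightarrow>
     (\<forall>s\<ge>0. \<forall>h\<ge>0.
        distr M borel (\<lambda>\<omega>. X (s + h) \<omega> - X s \<omega>) = distr M borel (\<lambda>\<omega>. X h \<omega> - X 0 \<omega>))"

definition independent_increments :: "'w measure \<Rightarrow> (real \<Rightarrow> 'w \<Rightarrow> real) \<Rightarrow> bool" where
  "independent_increments M X \<longleftrightarrow>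
     (\<forall>(n::nat) t. 0 \<le> t 0 \<and> (\<forall>i<n. t i \<le> t (Suc i)) \<longrightarrow>
        prob_space.indep_vars M (\<lambda>_. borel) (\<lambda>i \<omega>. X (t (Suc i)) \<omega> - X (t i) \<omega>) {..<n})"

text \<open>
  The start at 0 is almost sure: this is all that is preserved when a process is specified
  only up to equality in distribution.
\<close>

definition levy_process :: "'w measure \<Rightarrow> (real \<Rightarrow> 'w \<Rightarrow> real) \<Rightarrow> bool" where
  "levy_process M X \<longleftrightarrow>
     real_process M X \<and> (AE \<omega> in M. X 0 \<omega> = 0) \<and>
     stochastically_continuous M X \<and> stationary_increments M X \<and> independent_increments M X"

definition positive_levy_process :: "'w measure \<Rightarrow> (real \<Rightarrow> 'w \<Rightarrow> real) \<Rightarrow> bool" where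
  "positive_levy_process M T \<longleftrightarrow> levy_process M T \<and> (\<forall>t\<ge>0. \<forall>\<omega>\<in>space M. 0 \<le> T t \<omega>)"

definition semi_stable_process :: "real \<Rightarrow> real \<Rightarrow> 'w measure \<Rightarrow> (real \<Rightarrow> 'w \<Rightarrow> real) \<Rightarrow> bool" where
  "semi_stable_process a b M Y \<longleftrightarrow>
     levy_process M Y \<and> semi_stable a b (char (distr M borel (Y 1)))"

definition semi_selfdecomposable_process :: "real \<Rightarrow> 'w measure \<Rightarrow> (real \<Rightarrow> 'w \<Rightarrow> real) \<Rightarrow> bool" where
  "semi_selfdecomposable_process b M X \<longleftrightarrow>
     levy_process M X \<and> semi_selfdecomposable b (char (distr M borel (X 1)))"

definition positive_selfdecomposable_process :: "'w measure \<Rightarrow> (real \<Rightarrow> 'w \<Rightarrow> real) \<Rightarrow> bool" where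
  "positive_selfdecomposable_process M T \<longleftrightarrow>
     positive_levy_process M T \<and> nonneg_selfdecomposable (distr M borel (T 1))"


section \<open>Subordination\<close>

definition independent_processes ::
    "'w measure \<Rightarrow> (real \<Rightarrow> 'w \<Rightarrow> real) \<Rightarrow> (real \<Rightarrow> 'w \<Rightarrow> real) \<Rightarrow> bool" where
  "independent_processes M Y T \<longleftrightarrow>
     prob_space.indep_var M
       (PiM {0..} (\<lambda>_. borel)) (\<lambda>\<omega>. \<lambda>t\<in>{0..}. Y t \<omega>)
       (PiM {0..} (\<lambda>_. borel)) (\<lambda>\<omega>. \<lambda>t\<in>{0..}. T t \<omega>)"

definition equal_in_distribution ::
    "'v measure \<Rightarrow> (real \<Rightarrow> 'v \<Rightarrow> real) \<Rightarrow> 'w measure \<Rightarrow> (real \<Rightarrow> 'w \<Rightarrow> real) \<Rightarrow> bool" where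
  "equal_in_distribution N X M Z \<longleftrightarrow>
     (\<forall>J. finite J \<and> J \<subseteq> {0..} \<longrightarrow>
        distr N (PiM J (\<lambda>_. borel)) (\<lambda>\<omega>. \<lambda>t\<in>J. X t \<omega>) =
        distr M (PiM J (\<lambda>_. borel)) (\<lambda>\<omega>. \<lambda>t\<in>J. Z t \<omega>))"

definition right_continuous_modification ::
    "'w measure \<Rightarrow> (real \<Rightarrow> 'w \<Rightarrow> real) \<Rightarrow> (real \<Rightarrow> 'w \<Rightarrow> real) \<Rightarrow> bool" where
  "right_continuous_modification M Y Y' \<longleftrightarrow>
     real_process M Y' \<and>
     (\<forall>t\<ge>0. AE \<omega> in M. Y' t \<omega> = Y t \<omega>) \<and>
     (\<forall>\<omega>\<in>space M. \<forall>t\<ge>0. continuous (at_right t) (\<lambda>s. Y' s \<omega>))"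

text \<open>
  The finite-dimensional distributions of \<open>Y\<close> do not determine the law of \<open>Y (T t)\<close>:
  modifying \<open>Y\<close> on the null events \<open>T t = s\<close>, for each \<open>s\<close>, keeps \<open>Y\<close> a Levy process independent
  of \<open>T\<close> but can change \<open>Y (T t)\<close> arbitrarily. The composition therefore refers to a
  right-continuous modification of \<open>Y\<close>. Every Levy process has one, any two of them are
  indistinguishable on \<open>{0..}\<close>, and \<open>Y\<close> itself serves if its paths are right-continuous.
\<close>

definition subordinated ::
    "'v measure \<Rightarrow> (real \<Rightarrow> 'v \<Rightarrow> real) \<Rightarrow> 'w measure \<Rightarrow>
     (real \<Rightarrow> 'w \<Rightarrow> real) \<Rightarrow> (real \<Rightarrow> 'w \<Rightarrow> real) \<Rightarrow> bool" where
  "subordinated N X M Y T \<longleftrightarrow>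
     levy_process M Y \<and> positive_levy_process M T \<and> independent_processes M Y T \<and>
     real_process N X \<and>
     (\<exists>Y'. right_continuous_modification M Y Y' \<and>
           equal_in_distribution N X M (\<lambda>t \<omega>. Y' (T t \<omega>) \<omega>))"

end

theory Submission
  imports Defs
begin

text \<open>
  Right-continuity of \<open>Y'\<close> allows \<open>T\<close> to be approximated from above by times with values in a
  countable grid; independence and Fubini then give, for bounded uniformly continuous \<open>g\<^sub>i\<close>,
  that the mean of the product of the \<open>g\<^sub>i (X (t\<^sub>i\<^sub>+\<^sub>1) - X (t\<^sub>i))\<close> equals the mean of the product
  of the \<open>G\<^sub>i (T (t\<^sub>i\<^sub>+\<^sub>1) - T (t\<^sub>i))\<close>, where \<open>G\<^sub>i x\<close> is the mean of \<open>g\<^sub>i (Y x - Y 0)\<close>. This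
  single identity makes \<open>X\<close> a Levy process and gives \<open>X 1\<close> the characteristic function
  \<open>\<phi> (\<psi> u)\<close>, where \<open>\<phi>\<close> is the Laplace transform of \<open>T 1\<close> on the closed right half plane.

  By uniqueness of Laplace transforms, selfdecomposability says that \<open>T 1\<close> has the law of
  \<open>c T 1 + V\<close> with \<open>V\<close> independent of \<open>T 1\<close>, so \<open>\<phi> z = \<phi> (c z) \<phi>\<^sub>c z\<close> also for complex \<open>z\<close>.
  With \<open>c = 1 / a\<close>, semi-stability turns \<open>\<phi> (\<psi> u / a)\<close> into \<open>\<phi> (\<psi> (b u))\<close>, and the cofactor
  \<open>\<phi>\<^sub>c (\<psi> u)\<close> is the characteristic function of \<open>Y\<close> evaluated at the independent time \<open>V\<close>.
\<close>

section \<open>Increments of Levy processes\<close>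

lemma levy_process_prob_space: "levy_process M W \<Longrightarrow> prob_space M"
  by (simp add: levy_process_def real_process_def)

lemma levy_process_measurable:
  "levy_process M W \<Longrightarrow> 0 \<le> t \<Longrightarrow> W t \<in> borel_measurable M"
  by (simp add: levy_process_def real_process_def)

lemma levy_increment_distr:
  assumes "levy_process M W" "0 \<le> s" "s \<le> t"
  shows "distr M borel (\<lambda>\<omega>. W t \<omega> - W s \<omega>) = distr M borel (\<lambda>\<omega>. W (t - s) \<omega> - W 0 \<omega>)"
proof -
  have "stationary_increments M W" "0 \<le> t - s" "s + (t - s) = t"
    using assms by (auto simp: levy_process_def)
  then show ?thesis
    using assms(2) unfolding stationary_increments_def by metis
qed

text \<open>The increment from time 0 is used instead of \<open>W t\<close>: stationarity compares
  with \<open>W h - W 0\<close>, and the start at 0 is only almost sure. As a function of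
  \<open>t\<close> this is the convolution semigroup of \<open>W\<close>, applied to
  \<open>g\<close> and read at 0.\<close>

definition increment_mean ::
    "'w measure \<Rightarrow> (real \<Rightarrow> 'w \<Rightarrow> real) \<Rightarrow> (real \<Rightarrow> 'b) \<Rightarrow> real \<Rightarrow> 'b::{banach, second_countable_topology}"
  where "increment_mean M W g t = (LINT \<omega>|M. g (W t \<omega> - W 0 \<omega>))"

lemma levy_increment_integral:
  fixes g :: "real \<Rightarrow> 'b::{banach, second_countable_topology}"
  assumes L: "levy_process M W" and st: "0 \<le> s" "s \<le> t" and [measurable]: "g \<in> borel_measurable borel"
  shows "(LINT \<omega>|M. g (W t \<omega> - W s \<omega>)) = increment_mean M W g (t - s)"
proof -
  have [measurable]: "W t \<in> borel_measurable M" "W s \<in> borel_measurable M"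
      "W (t - s) \<in> borel_measurable M" "W 0 \<in> borel_measurable M"
    using levy_process_measurable[OF L] st by auto
  have "(LINT \<omega>|M. g (W t \<omega> - W s \<omega>)) = (LINT x|distr M borel (\<lambda>\<omega>. W t \<omega> - W s \<omega>). g x)"
    by (subst integral_distr) auto
  also have "\<dots> = (LINT x|distr M borel (\<lambda>\<omega>. W (t - s) \<omega> - W 0 \<omega>). g x)"
    by (simp add: levy_increment_distr[OF L st])
  also have "\<dots> = increment_mean M W g (t - s)"
    unfolding increment_mean_def by (subst integral_distr) auto
  finally show ?thesis .
qed

lemma levy_increment_measure:
  assumes L: "levy_process M W" and st: "0 \<le> s" "s \<le> t" and A[measurable]: "A \<in> sets borel"
  shows "measure M {\<omega> \<in> space M. W t \<omega> - W s \<omega> \<in> A} = measure M {\<omega> \<in> space M. W (t - s) \<omega> - W 0 \<omega> \<in> A}"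
proof -
  have [measurable]: "W t \<in> borel_measurable M" "W s \<in> borel_measurable M"
      "W (t - s) \<in> borel_measurable M" "W 0 \<in> borel_measurable M"
    using levy_process_measurable[OF L] st by auto
  have "measure (distr M borel (\<lambda>\<omega>. W t \<omega> - W s \<omega>)) A =
        measure (distr M borel (\<lambda>\<omega>. W (t - s) \<omega> - W 0 \<omega>)) A"
    by (simp add: levy_increment_distr[OF L st])
  then show ?thesis
    by (simp add: measure_distr vimage_def Int_def conj_commute)
qed

text \<open>Independence splits the mean of the product and stationarity evaluates each factor. The
  value type covers real test functions, which detect independence, as well as complex exponentials,
  which give characteristic functions.\<close>

lemma levy_increment_mean_prod:
  fixes g :: "nat \<Rightarrow> real \<Rightarrow> 'b::{real_normed_field, banach, second_countable_topology}"
  assumes L: "levy_process M W" and t0: "0 \<le> t 0" and mono: "\<And>i. i < n \<Longrightarrow> t i \<le> t (Suc i)"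
    and g[measurable]: "\<And>i. i < n \<Longrightarrow> g i \<in> borel_measurable borel"
    and B: "\<And>i x. i < n \<Longrightarrow> norm (g i x) \<le> B"
  shows "(LINT \<omega>|M. (\<Prod>i<n. g i (W (t (Suc i)) \<omega> - W (t i) \<omega>))) =
         (\<Prod>i<n. increment_mean M W (g i) (t (Suc i) - t i))"
proof -
  interpret prob_space M using levy_process_prob_space[OF L] .
  have nonneg: "0 \<le> t i" if "i \<le> n" for i
    using that
  proof (induction i)
    case (Suc i)
    then show ?case using mono[of i] by simp
  qed (simp add: t0)
  have [measurable]: "W (t i) \<in> borel_measurable M" if "i \<le> n" for i
    using levy_process_measurable[OF L nonneg[OF that]] .
  have "indep_vars (\<lambda>_. borel) (\<lambda>i \<omega>. W (t (Suc i)) \<omega> - W (t i) \<omega>) {..<n}"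
    using L t0 mono by (auto simp: levy_process_def independent_increments_def)
  then have "indep_vars (\<lambda>_. borel) (\<lambda>i \<omega>. g i (W (t (Suc i)) \<omega> - W (t i) \<omega>)) {..<n}"
    by (rule indep_vars_compose2) auto
  then have "(LINT \<omega>|M. (\<Prod>i<n. g i (W (t (Suc i)) \<omega> - W (t i) \<omega>))) =
             (\<Prod>i<n. LINT \<omega>|M. g i (W (t (Suc i)) \<omega> - W (t i) \<omega>))"
    by (intro indep_vars_lebesgue_integral)
       (auto intro!: integrable_const_bound[where B=B] AE_I2 B)
  also have "\<dots> = (\<Prod>i<n. increment_mean M W (g i) (t (Suc i) - t i))"
    by (intro prod.cong levy_increment_integral[OF L]) (auto simp: nonneg mono)
  finally show ?thesis .
qed

lemma norm_increment_mean_le: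
  fixes g :: "real \<Rightarrow> 'b::{banach, second_countable_topology}"
  assumes L: "levy_process M W" and t: "0 \<le> t"
    and [measurable]: "g \<in> borel_measurable borel" and B: "\<And>x. norm (g x) \<le> B"
  shows "norm (increment_mean M W g t) \<le> B"
proof -
  have "0 \<le> B" using B[of 0] norm_ge_zero[of "g 0"] by linarith
  interpret prob_space M using levy_process_prob_space[OF L] .
  have [measurable]: "W t \<in> borel_measurable M" "W 0 \<in> borel_measurable M"
    using levy_process_measurable[OF L] t by auto
  have "norm (increment_mean M W g t) \<le> (LINT \<omega>|M. norm (g (W t \<omega> - W 0 \<omega>)))"
    unfolding increment_mean_def by (rule integral_norm_bound)
  also have "\<dots> \<le> (LINT \<omega>|M. B)"
    by (intro integral_mono integrable_const_bound[where B=B]) (auto simp: B \<open>0 \<le> B\<close>)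
  finally show ?thesis by (simp add: prob_space)
qed

text \<open>By stationarity the event that \<open>W\<close> moves far between \<open>s\<close> and
  \<open>t\<close> has a probability depending only on \<open>t - s\<close>. Stochastic continuity
  at time 0 alone therefore controls all pairs of nearby times at once.\<close>

lemma increment_mean_uniformly_continuous:
  fixes g :: "real \<Rightarrow> 'b::{banach, second_countable_topology}"
  assumes L: "levy_process M W"
    and uc: "uniformly_continuous_on UNIV g" and B: "\<And>x. norm (g x) \<le> B"
  shows "uniformly_continuous_on {0..} (increment_mean M W g)"
proof -
  interpret prob_space M using levy_process_prob_space[OF L] .
  have gm[measurable]: "g \<in> borel_measurable borel"
    using uc by (intro borel_measurable_continuous_onI uniformly_continuous_imp_continuous)
  have B0: "0 \<le> B" using B[of 0] norm_ge_zero[of "g 0"] by linarith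
  have key: "\<exists>d>0. \<forall>s t. 0 \<le> s \<and> s \<le> t \<and> t - s < d \<longrightarrow>
     dist (increment_mean M W g t) (increment_mean M W g s) < e" if e: "e > 0" for e
  proof -
    obtain \<delta> where \<delta>: "\<delta> > 0" "\<And>x y. dist x y < \<delta> \<Longrightarrow> dist (g x) (g y) < e / 2"
      using uc e unfolding uniformly_continuous_on_def by (metis UNIV_I half_gt_zero)
    have "((\<lambda>h. measure M {\<omega> \<in> space M. \<bar>W h \<omega> - W 0 \<omega>\<bar> > \<delta> / 2}) \<longlongrightarrow> 0) (at 0 within {0..})"
      using L half_gt_zero[OF \<delta>(1)] unfolding levy_process_def stochastically_continuous_def by blast
    \<comment> \<open>On the event of a large increment the integrand is at most
      \<open>2 * B\<close>, elsewhere at most \<open>e / 2\<close>. The bound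
      \<open>e / (4 * B + 4)\<close> keeps the first contribution below \<open>e / 2\<close>, and
      its denominator stays positive when \<open>B = 0\<close>.\<close>
    then have "\<forall>\<^sub>F h in at 0 within {0..}. measure M {\<omega> \<in> space M. \<bar>W h \<omega> - W 0 \<omega>\<bar> > \<delta> / 2} < e / (4 * B + 4)"
      using e B0 by (intro order_tendstoD) auto
    then obtain \<eta> where \<eta>: "\<eta> > 0"
      "\<And>h. 0 \<le> h \<Longrightarrow> h \<noteq> 0 \<Longrightarrow> h < \<eta> \<Longrightarrow>
         measure M {\<omega> \<in> space M. \<bar>W h \<omega> - W 0 \<omega>\<bar> > \<delta> / 2} < e / (4 * B + 4)"
      by (auto simp: eventually_at dist_real_def)
    have "dist (increment_mean M W g t) (increment_mean M W g s) < e"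
      if st: "0 \<le> s" "s \<le> t" "t - s < \<eta>" for s t
    proof (cases "s = t")
      case False
      have [measurable]: "W t \<in> borel_measurable M" "W s \<in> borel_measurable M" "W 0 \<in> borel_measurable M"
        using levy_process_measurable[OF L] st by auto
      define A where "A = {\<omega> \<in> space M. \<bar>W t \<omega> - W s \<omega>\<bar> > \<delta> / 2}"
      have [measurable]: "A \<in> sets M" unfolding A_def by measurable
      have "measure M A = measure M {\<omega> \<in> space M. W t \<omega> - W s \<omega> \<in> {x. \<bar>x\<bar> > \<delta> / 2}}"
        by (simp add: A_def)
      also have "\<dots> = measure M {\<omega> \<in> space M. W (t - s) \<omega> - W 0 \<omega> \<in> {x. \<bar>x\<bar> > \<delta> / 2}}"
        by (intro levy_increment_measure[OF L] st) auto
      also have "\<dots> < e / (4 * B + 4)"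
        using \<eta>(2)[of "t - s"] st False by simp
      finally have PA: "measure M A < e / (4 * B + 4)" .
      have int: "integrable M (\<lambda>\<omega>. g (W r \<omega> - W 0 \<omega>))" if "0 \<le> r" for r
        using levy_process_measurable[OF L, of r] that
        by (intro integrable_const_bound[where B=B]) (auto simp: B)
      have "dist (increment_mean M W g t) (increment_mean M W g s) =
         norm (LINT \<omega>|M. g (W t \<omega> - W 0 \<omega>) - g (W s \<omega> - W 0 \<omega>))"
        unfolding increment_mean_def dist_norm using st by (subst Bochner_Integration.integral_diff) (auto intro!: int)
      also have "\<dots> \<le> (LINT \<omega>|M. norm (g (W t \<omega> - W 0 \<omega>) - g (W s \<omega> - W 0 \<omega>)))"
        by (rule integral_norm_bound)
      also have "\<dots> \<le> (LINT \<omega>|M. e / 2 + 2 * B * indicator A \<omega>)"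
      proof (rule integral_mono)
        show "integrable M (\<lambda>\<omega>. norm (g (W t \<omega> - W 0 \<omega>) - g (W s \<omega> - W 0 \<omega>)))"
          using st by (intro integrable_norm Bochner_Integration.integrable_diff int) auto
        show "integrable M (\<lambda>\<omega>. e / 2 + 2 * B * indicator A \<omega>)" by (auto simp: emeasure_eq_measure)
        fix \<omega> assume \<omega>: "\<omega> \<in> space M"
        show "norm (g (W t \<omega> - W 0 \<omega>) - g (W s \<omega> - W 0 \<omega>)) \<le> e / 2 + 2 * B * indicator A \<omega>"
        proof (cases "\<omega> \<in> A")
          case True
          have "norm (g (W t \<omega> - W 0 \<omega>) - g (W s \<omega> - W 0 \<omega>)) \<le> B + B"
            by (intro order_trans[OF norm_triangle_ineq4] add_mono B)
          then show ?thesis using True e by simp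
        next
          case False
          then have "dist (W t \<omega> - W 0 \<omega>) (W s \<omega> - W 0 \<omega>) < \<delta>"
            using \<omega> \<delta>(1) by (auto simp: A_def dist_real_def)
          then show ?thesis using \<delta>(2) False by (fastforce simp: dist_norm)
        qed
      qed
      also have "\<dots> = e / 2 + 2 * B * measure M A"
        by (simp add: emeasure_eq_measure prob_space)
      also have "\<dots> \<le> e / 2 + 2 * B * (e / (4 * B + 4))"
        using PA B0 by (intro add_left_mono mult_left_mono) auto
      also have "\<dots> < e" using e B0 by (simp add: field_simps)
      finally show ?thesis .
    qed (use e in simp)
    then show ?thesis using \<eta>(1) by blast
  qed
  show ?thesis
    unfolding uniformly_continuous_on_def
  proof (intro allI impI)
    fix e :: real assume "e > 0"
    from key[OF this] obtain d where d: "d > 0"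
      "\<And>s t. 0 \<le> s \<and> s \<le> t \<and> t - s < d \<Longrightarrow> dist (increment_mean M W g t) (increment_mean M W g s) < e"
      by blast
    show "\<exists>d>0. \<forall>x\<in>{0..}. \<forall>x'\<in>{0..}. dist x' x < d \<longrightarrow>
            dist (increment_mean M W g x') (increment_mean M W g x) < e"
    proof (intro exI[of _ d] conjI ballI impI d(1))
      fix x x' :: real assume "x \<in> {0..}" "x' \<in> {0..}" "dist x' x < d"
      then show "dist (increment_mean M W g x') (increment_mean M W g x) < e"
        using d(2)[of x x'] d(2)[of x' x] by (cases "x \<le> x'") (auto simp: dist_real_def dist_commute)
    qed
  qed
qed

text \<open>The map \<open>x\<close> to \<open>\<bar>x\<bar>\<close> is 1-Lipschitz, so the modulus
  of continuity is kept. This extension to the whole line lets a mean over \<open>Y\<close>, as a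
  function of time, serve as a test function for increments of \<open>T\<close>; these are almost
  surely nonnegative, so the absolute value does not change them.\<close>

lemma uniformly_continuous_on_compose_abs:
  fixes f :: "real \<Rightarrow> 'b::metric_space"
  assumes "uniformly_continuous_on {0..} f"
  shows "uniformly_continuous_on UNIV (\<lambda>x. f \<bar>x\<bar>)"
  unfolding uniformly_continuous_on_def
proof (intro allI impI)
  fix e :: real assume "e > 0"
  then obtain d where d: "d > 0" "\<And>x x'. 0 \<le> x \<Longrightarrow> 0 \<le> x' \<Longrightarrow> dist x' x < d \<Longrightarrow> dist (f x') (f x) < e"
    using assms unfolding uniformly_continuous_on_def by (metis atLeast_iff)
  show "\<exists>d>0. \<forall>x\<in>UNIV. \<forall>x'\<in>UNIV. dist x' x < d \<longrightarrow> dist (f \<bar>x'\<bar>) (f \<bar>x\<bar>) < e"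
    using d(1) by (intro exI[of _ d]) (auto intro!: d(2) simp: dist_real_def)
qed

lemma increment_mean_abs_uniformly_continuous:
  fixes g :: "real \<Rightarrow> 'b::{banach, second_countable_topology}"
  assumes "levy_process M W"
    and "uniformly_continuous_on UNIV g" and "\<And>x. norm (g x) \<le> B"
  shows "uniformly_continuous_on UNIV (\<lambda>x. increment_mean M W g \<bar>x\<bar>)"
  by (intro uniformly_continuous_on_compose_abs increment_mean_uniformly_continuous[OF assms])

text \<open>The increment has the law of \<open>T (t - s) - T 0\<close>, where \<open>T 0\<close>
  vanishes almost surely and \<open>T (t - s)\<close> is nonnegative. The exceptional event depends
  on the two times; later only finitely many times are compared.\<close>

lemma positive_levy_process_mono:
  assumes P: "positive_levy_process M T" and st: "0 \<le> s" "s \<le> t"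
  shows "AE \<omega> in M. T s \<omega> \<le> T t \<omega>"
proof -
  have L: "levy_process M T" and pos: "\<And>r \<omega>. 0 \<le> r \<Longrightarrow> \<omega> \<in> space M \<Longrightarrow> 0 \<le> T r \<omega>"
    using P by (auto simp: positive_levy_process_def)
  interpret prob_space M using levy_process_prob_space[OF L] .
  have [measurable]: "T t \<in> borel_measurable M" "T s \<in> borel_measurable M"
      "T (t - s) \<in> borel_measurable M" "T 0 \<in> borel_measurable M"
    using levy_process_measurable[OF L] st by auto
  have "AE \<omega> in M. T 0 \<omega> = 0" using L by (simp add: levy_process_def)
  then have "AE \<omega> in M. \<not> (T (t - s) \<omega> - T 0 \<omega> \<in> {..<0})"
    using AE_space by eventually_elim (use pos[of "t - s"] st in \<open>auto simp: not_less\<close>)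
  then have "measure M {\<omega> \<in> space M. T (t - s) \<omega> - T 0 \<omega> \<in> {..<0}} = 0"
    by (subst prob_eq_0) auto
  then have "measure M {\<omega> \<in> space M. T t \<omega> - T s \<omega> \<in> {..<0}} = 0"
    using levy_increment_measure[OF L st, of "{..<0}"] by simp
  then have "AE \<omega> in M. \<not> (T t \<omega> - T s \<omega> \<in> {..<0})"
    by (subst (asm) prob_eq_0) auto
  then show ?thesis
    by eventually_elim (auto simp: not_less)
qed


section \<open>Discretization from the right\<close>

text \<open>
  Since \<^term>\<open>nat\<close> truncates, negative arguments are sent to the first point of the grid, and
  every value is strictly positive.
\<close>

definition grid :: "nat \<Rightarrow> real \<Rightarrow> real" where
  "grid k x = (real (nat \<lfloor>real (Suc k) * x\<rfloor>) + 1) / real (Suc k)"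

lemma grid_pos: "0 < grid k x"
  unfolding grid_def by (intro divide_pos_pos add_nonneg_pos) simp_all

lemma grid_mono: "x \<le> y \<Longrightarrow> grid k x \<le> grid k y"
proof -
  assume "x \<le> y"
  then have "real (Suc k) * x \<le> real (Suc k) * y" by (rule mult_left_mono) simp
  then have "nat \<lfloor>real (Suc k) * x\<rfloor> \<le> nat \<lfloor>real (Suc k) * y\<rfloor>" by (intro nat_mono floor_mono)
  then show "grid k x \<le> grid k y"
    unfolding grid_def by (intro divide_right_mono) simp_all
qed

lemma grid_gt:
  assumes "0 \<le> x"
  shows "x < grid k x"
proof -
  have "0 \<le> \<lfloor>real (Suc k) * x\<rfloor>" using assms by simp
  then have "real (nat \<lfloor>real (Suc k) * x\<rfloor>) + 1 > real (Suc k) * x"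
    by (simp only: of_nat_nat) linarith
  then show ?thesis by (simp add: grid_def field_simps)
qed

lemma grid_le:
  assumes "0 \<le> x"
  shows "grid k x \<le> x + 1 / real (Suc k)"
proof -
  have "0 \<le> \<lfloor>real (Suc k) * x\<rfloor>" using assms by simp
  then have "real (nat \<lfloor>real (Suc k) * x\<rfloor>) + 1 \<le> real (Suc k) * x + 1"
    by (simp only: of_nat_nat) linarith
  then have "grid k x \<le> (real (Suc k) * x + 1) / real (Suc k)"
    unfolding grid_def by (rule divide_right_mono) simp
  also have "\<dots> = x + 1 / real (Suc k)" by (simp add: field_simps)
  finally show ?thesis .
qed

lemma grid_tendsto:
  assumes "0 \<le> x"
  shows "(\<lambda>k. grid k x) \<longlonglongrightarrow> x"
proof (rule tendsto_sandwich)
  show "\<forall>\<^sub>F k in sequentially. x \<le> grid k x"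
    using grid_gt[OF assms] by (intro always_eventually) (auto intro: less_imp_le)
  show "\<forall>\<^sub>F k in sequentially. grid k x \<le> x + 1 / real (Suc k)"
    using grid_le[OF assms] by simp
  have "(\<lambda>k. x + 1 / real (Suc k)) \<longlonglongrightarrow> x + 0"
    by (intro tendsto_add tendsto_const LIMSEQ_Suc[OF lim_1_over_n])
  then show "(\<lambda>k. x + 1 / real (Suc k)) \<longlonglongrightarrow> x" by simp
qed simp

text \<open>The grid points lie strictly to the right of \<open>x\<close>, so they converge along
  the filter \<open>at_right x\<close>, the only one for which continuity is assumed.\<close>

lemma right_continuous_grid_tendsto:
  assumes "0 \<le> x" and "continuous (at_right x) f"
  shows "(\<lambda>k. f (grid k x)) \<longlonglongrightarrow> f x"
proof -
  have "filterlim (\<lambda>k. grid k x) (at_right x) sequentially"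
    unfolding filterlim_at using grid_tendsto[OF assms(1)] grid_gt[OF assms(1)]
    by (auto intro!: always_eventually simp: less_imp_neq[THEN not_sym])
  moreover have "(f \<longlongrightarrow> f x) (at_right x)"
    using assms(2) by (simp add: continuous_within)
  ultimately show ?thesis
    by (rule filterlim_compose[rotated])
qed

text \<open>Grid times take countably many values, so evaluation at a random grid time is a
  countable case distinction. Measurability of \<open>Z\<close> at each fixed time suffices; joint
  measurability is not assumed.\<close>

lemma grid_compose_measurable:
  assumes Z: "\<And>q. 0 < q \<Longrightarrow> Z q \<in> measurable M N" and [measurable]: "V \<in> borel_measurable M"
  shows "(\<lambda>\<omega>. Z (grid k (V \<omega>)) \<omega>) \<in> measurable M N"
proof -
  have "(\<lambda>\<omega>. Z ((real i + 1) / real (Suc k)) \<omega>) \<in> measurable M N" for i :: nat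
    by (rule Z) (simp add: divide_pos_pos add_nonneg_pos)
  moreover have "(\<lambda>\<omega>. nat \<lfloor>real (Suc k) * V \<omega>\<rfloor>) \<in> measurable M (count_space UNIV)"
    by measurable
  ultimately show ?thesis
    unfolding grid_def by (rule measurable_compose_countable)
qed

lemma grid_measurable[measurable]: "grid k \<in> borel_measurable borel"
  by (rule grid_compose_measurable[where Z="\<lambda>q x. q" and V="\<lambda>x. x"]) simp_all

text \<open>The composition is the pointwise limit of its values at the grid times above
  \<open>V\<close>. Since these are positive, \<open>Z\<close> is only evaluated at positive times
  before the limit.\<close>

lemma right_continuous_compose_measurable:
  fixes Z :: "real \<Rightarrow> 'a \<Rightarrow> 'b::metric_space"
  assumes Z: "\<And>q. 0 < q \<Longrightarrow> Z q \<in> borel_measurable M"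
    and V: "V \<in> borel_measurable M" "\<And>\<omega>. \<omega> \<in> space M \<Longrightarrow> 0 \<le> V \<omega>"
    and rc: "\<And>\<omega> t. \<omega> \<in> space M \<Longrightarrow> 0 \<le> t \<Longrightarrow> continuous (at_right t) (\<lambda>s. Z s \<omega>)"
  shows "(\<lambda>\<omega>. Z (V \<omega>) \<omega>) \<in> borel_measurable M"
proof (rule borel_measurable_LIMSEQ_metric)
  show "(\<lambda>\<omega>. Z (grid k (V \<omega>)) \<omega>) \<in> borel_measurable M" for k
    using Z V(1) by (rule grid_compose_measurable)
  show "(\<lambda>k. Z (grid k (V \<omega>)) \<omega>) \<longlonglongrightarrow> Z (V \<omega>) \<omega>" if "\<omega> \<in> space M" for \<omega>
    using that V(2) rc by (intro right_continuous_grid_tendsto) auto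
qed


section \<open>Increments of a subordinated process\<close>

lemma norm_prod_le_power:
  fixes f :: "nat \<Rightarrow> 'b::real_normed_field"
  assumes "\<And>i. i < n \<Longrightarrow> norm (f i) \<le> B"
  shows "norm (\<Prod>i<n. f i) \<le> B ^ n"
proof -
  have "norm (\<Prod>i<n. f i) = (\<Prod>i<n. norm (f i))" by (simp add: prod_norm)
  also have "\<dots> \<le> (\<Prod>i<n. B)" using assms by (intro prod_mono) auto
  finally show ?thesis by simp
qed

text \<open>Independence makes the joint law of the two paths a product measure on path space.
  Fubini freezes the path of \<open>T\<close>; the times at which \<open>Y\<close> is read are then
  deterministic, and the product formula for increments of \<open>Y\<close> applies.\<close>

lemma grid_subordination_mean_prod:
  fixes g :: "nat \<Rightarrow> real \<Rightarrow> 'b::{real_normed_field, banach, second_countable_topology}"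
  assumes Y: "levy_process M Y" and T: "levy_process M T" and I: "independent_processes M Y T"
    and t: "\<And>i. i \<le> n \<Longrightarrow> 0 \<le> t i"
    and mono: "\<And>i. i < n \<Longrightarrow> AE \<omega> in M. T (t i) \<omega> \<le> T (t (Suc i)) \<omega>"
    and g[measurable]: "\<And>i. i < n \<Longrightarrow> g i \<in> borel_measurable borel"
    and B: "\<And>i x. i < n \<Longrightarrow> norm (g i x) \<le> B"
    and G[measurable]: "\<And>i. i < n \<Longrightarrow> (\<lambda>x. increment_mean M Y (g i) \<bar>x\<bar>) \<in> borel_measurable borel"
  shows "(LINT \<omega>|M. (\<Prod>i<n. g i (Y (grid k (T (t (Suc i)) \<omega>)) \<omega> - Y (grid k (T (t i) \<omega>)) \<omega>))) =
    (LINT \<omega>|M. (\<Prod>i<n. increment_mean M Y (g i)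
       \<bar>grid k (T (t (Suc i)) \<omega>) - grid k (T (t i) \<omega>)\<bar>))"
proof -
  interpret prob_space M using levy_process_prob_space[OF Y] .
  define S where "S = PiM {0..} (\<lambda>_::real. borel :: real measure)"
  define YY where "YY = (\<lambda>\<omega>. \<lambda>t\<in>{0..}. Y t \<omega>)"
  define TT where "TT = (\<lambda>\<omega>. \<lambda>t\<in>{0..}. T t \<omega>)"
  have ind: "indep_var S YY S TT"
    using I unfolding independent_processes_def S_def YY_def TT_def .
  then have YYm[measurable]: "YY \<in> measurable M S" and TTm[measurable]: "TT \<in> measurable M S"
    and joint: "distr M S YY \<Otimes>\<^sub>M distr M S TT = distr M (S \<Otimes>\<^sub>M S) (\<lambda>\<omega>. (YY \<omega>, TT \<omega>))"
    by (auto simp: indep_var_distribution_eq)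
  interpret YY: prob_space "distr M S YY" by (rule prob_space_distr) simp
  interpret TT: prob_space "distr M S TT" by (rule prob_space_distr) simp
  interpret P: pair_prob_space "distr M S YY" "distr M S TT" ..
  have comp[measurable]: "(\<lambda>y. y q) \<in> borel_measurable S" if "0 \<le> q" for q
    unfolding S_def using that by (intro measurable_component_singleton) auto
  define F where "F = (\<lambda>y \<tau>. \<Prod>i<n. g i (y (grid k (\<tau> (t (Suc i)))) - y (grid k (\<tau> (t i)))))"
  \<comment> \<open>Evaluating a path at a time taken from another path need not be measurable for
    the product sigma-algebra. Rounding the time to the grid repairs this.\<close>
  have ev[measurable]: "(\<lambda>p. fst p (grid k (snd p (t i)))) \<in> borel_measurable (S \<Otimes>\<^sub>M S)" if "i \<le> n" for i
  proof (rule grid_compose_measurable)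
    show "(\<lambda>p. fst p q) \<in> borel_measurable (S \<Otimes>\<^sub>M S)" if "0 < q" for q :: real
      by (rule measurable_compose[OF measurable_fst comp]) (use that in simp)
    show "(\<lambda>p. snd p (t i)) \<in> borel_measurable (S \<Otimes>\<^sub>M S)"
      by (rule measurable_compose[OF measurable_snd comp]) (use t that in simp)
  qed
  have Fm[measurable]: "case_prod F \<in> borel_measurable (S \<Otimes>\<^sub>M S)"
    unfolding F_def case_prod_beta
    by (intro borel_measurable_prod measurable_compose[OF borel_measurable_diff g] ev) auto
  have FB: "norm (F y \<tau>) \<le> B ^ n" for y \<tau>
    unfolding F_def by (intro norm_prod_le_power B)
  have int: "integrable (distr M S YY \<Otimes>\<^sub>M distr M S TT) (case_prod F)"
    by (rule P.integrable_const_bound[where B="B ^ n"]) (auto simp: FB)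
  \<comment> \<open>Grid times are positive and the \<open>t i\<close> nonnegative, so the
    restriction of paths to \<open>{0..}\<close> never returns \<open>undefined\<close>
    here.\<close>
  have FYT: "F (YY \<omega>) (TT \<omega>') =
     (\<Prod>i<n. g i (Y (grid k (T (t (Suc i)) \<omega>')) \<omega> - Y (grid k (T (t i) \<omega>')) \<omega>))" for \<omega> \<omega>'
    unfolding F_def YY_def TT_def by (intro prod.cong refl) (simp add: t less_imp_le[OF grid_pos])
  have "(LINT \<omega>|M. (\<Prod>i<n. g i (Y (grid k (T (t (Suc i)) \<omega>)) \<omega> - Y (grid k (T (t i) \<omega>)) \<omega>))) =
        (LINT \<omega>|M. F (YY \<omega>) (TT \<omega>))"
    by (simp add: FYT)
  also have "\<dots> = (LINT p|distr M (S \<Otimes>\<^sub>M S) (\<lambda>\<omega>. (YY \<omega>, TT \<omega>)). case_prod F p)"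
    by (subst integral_distr) auto
  also have "\<dots> = (LINT p|(distr M S YY \<Otimes>\<^sub>M distr M S TT). case_prod F p)"
    by (simp add: joint)
  also have "\<dots> = (LINT \<tau>|distr M S TT. LINT y|distr M S YY. F y \<tau>)"
    by (rule P.integral_snd[OF int, symmetric])
  also have "\<dots> = (LINT \<omega>'|M. LINT y|distr M S YY. F y (TT \<omega>'))"
    by (subst integral_distr) auto
  also have "\<dots> = (LINT \<omega>'|M. LINT \<omega>|M. F (YY \<omega>) (TT \<omega>'))"
  proof (rule Bochner_Integration.integral_cong[OF refl])
    fix \<omega>' assume "\<omega>' \<in> space M"
    then have [measurable]: "TT \<omega>' \<in> space S" using measurable_space[OF TTm] by auto
    show "(LINT y|distr M S YY. F y (TT \<omega>')) = (LINT \<omega>|M. F (YY \<omega>) (TT \<omega>'))"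
      by (subst integral_distr) auto
  qed
  also have "\<dots> = (LINT \<omega>|M. (\<Prod>i<n. increment_mean M Y (g i)
       \<bar>grid k (T (t (Suc i)) \<omega>) - grid k (T (t i) \<omega>)\<bar>))"
  proof (rule integral_cong_AE)
    have gT[measurable]: "(\<lambda>\<omega>. grid k (T (t i) \<omega>)) \<in> borel_measurable M" if "i \<le> n" for i
      by (rule measurable_compose[OF levy_process_measurable[OF T] grid_measurable]) (use t that in auto)
    show "(\<lambda>\<omega>'. LINT \<omega>|M. F (YY \<omega>) (TT \<omega>')) \<in> borel_measurable M"
    proof -
      have "(\<lambda>p. F (YY (snd p)) (TT (fst p))) \<in> borel_measurable (M \<Otimes>\<^sub>M M)" by measurable
      then show ?thesis
        by (intro borel_measurable_lebesgue_integral) (simp add: case_prod_beta')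
    qed
    have "AE \<omega>' in M. \<forall>i<n. T (t i) \<omega>' \<le> T (t (Suc i)) \<omega>'"
      using mono by (auto simp: AE_all_countable)
    then show "AE \<omega>' in M. (LINT \<omega>|M. F (YY \<omega>) (TT \<omega>')) = (\<Prod>i<n. increment_mean M Y (g i)
       \<bar>grid k (T (t (Suc i)) \<omega>') - grid k (T (t i) \<omega>')\<bar>)"
    proof eventually_elim
      case (elim \<omega>')
      have "(LINT \<omega>|M. F (YY \<omega>) (TT \<omega>')) = (\<Prod>i<n. increment_mean M Y (g i)
          (grid k (T (t (Suc i)) \<omega>') - grid k (T (t i) \<omega>')))"
        unfolding FYT
        by (rule levy_increment_mean_prod[where t="\<lambda>i. grid k (T (t i) \<omega>')" and g=g and B=B, OF Y])
           (use elim in \<open>auto simp: less_imp_le[OF grid_pos] B intro!: grid_mono\<close>)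
      also have "\<dots> = (\<Prod>i<n. increment_mean M Y (g i)
          \<bar>grid k (T (t (Suc i)) \<omega>') - grid k (T (t i) \<omega>')\<bar>)"
        using elim by (intro prod.cong refl) (simp add: grid_mono)
      finally show ?case .
    qed
    show "(\<lambda>\<omega>. \<Prod>i<n. increment_mean M Y (g i)
       \<bar>grid k (T (t (Suc i)) \<omega>) - grid k (T (t i) \<omega>)\<bar>) \<in> borel_measurable M"
      by (intro borel_measurable_prod measurable_compose[OF borel_measurable_diff G] gT) auto
  qed
  finally show ?thesis .
qed


section \<open>Passage from grid times to the times given by \<open>T\<close>\<close>

lemma uniformly_continuous_imp_borel_measurable:
  fixes g :: "real \<Rightarrow> 'b::metric_space"
  shows "uniformly_continuous_on UNIV g \<Longrightarrow> g \<in> borel_measurable borel"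
  by (intro borel_measurable_continuous_onI uniformly_continuous_imp_continuous)

lemma borel_measurable_increment_prod:
  fixes g :: "nat \<Rightarrow> real \<Rightarrow> 'b::{real_normed_field, second_countable_topology}"
  assumes "\<And>i. i < n \<Longrightarrow> g i \<in> borel_measurable borel"
    and "\<And>i. i \<le> n \<Longrightarrow> V i \<in> borel_measurable M"
  shows "(\<lambda>\<omega>. \<Prod>i<n. g i (V (Suc i) \<omega> - V i \<omega>)) \<in> borel_measurable M"
proof (rule borel_measurable_prod)
  fix i assume i: "i \<in> {..<n}"
  have "(\<lambda>\<omega>. V (Suc i) \<omega> - V i \<omega>) \<in> borel_measurable M"
    using assms(2)[of i] assms(2)[of "Suc i"] i by (intro borel_measurable_diff) auto
  from measurable_compose[OF this assms(1)[of i]] i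
  show "(\<lambda>\<omega>. g i (V (Suc i) \<omega> - V i \<omega>)) \<in> borel_measurable M" by simp
qed

lemma tendsto_increment_prod:
  fixes g :: "nat \<Rightarrow> real \<Rightarrow> 'b::real_normed_field"
  assumes g: "\<And>i. i < n \<Longrightarrow> uniformly_continuous_on UNIV (g i)"
    and V: "\<And>i. i \<le> n \<Longrightarrow> (\<lambda>k. V k i) \<longlonglongrightarrow> W i"
  shows "(\<lambda>k. \<Prod>i<n. g i (V k (Suc i) - V k i)) \<longlonglongrightarrow> (\<Prod>i<n. g i (W (Suc i) - W i))"
proof (rule tendsto_prod)
  fix i assume i: "i \<in> {..<n}"
  then have "isCont (g i) (W (Suc i) - W i)"
    using uniformly_continuous_imp_continuous[OF g[of i]] by (simp add: continuous_on_eq_continuous_at)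
  then show "(\<lambda>k. g i (V k (Suc i) - V k i)) \<longlonglongrightarrow> g i (W (Suc i) - W i)"
    by (rule isCont_tendsto_compose) (use i in \<open>auto intro!: tendsto_diff V\<close>)
qed

text \<open>Both sides of the grid identity converge by dominated convergence with the constant
  bound \<open>B ^ n\<close>: the left side by right-continuity of the paths of \<open>Y'\<close>,
  the right side by continuity of the functions \<open>G i\<close>. The limit on the right is a mean
  over increments of \<open>T\<close> and factorizes because \<open>T\<close> is itself a Levy
  process.\<close>

lemma subordination_mean_prod:
  fixes g :: "nat \<Rightarrow> real \<Rightarrow> 'b::{real_normed_field, banach, second_countable_topology}"
  assumes Y: "levy_process M Y" and P: "positive_levy_process M T" and I: "independent_processes M Y T"
    and rcm: "right_continuous_modification M Y Y'"
    and t: "\<And>i. i \<le> n \<Longrightarrow> 0 \<le> t i" and mono: "\<And>i. i < n \<Longrightarrow> t i \<le> t (Suc i)"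
    and g: "\<And>i. i < n \<Longrightarrow> uniformly_continuous_on UNIV (g i)"
    and B: "\<And>i x. i < n \<Longrightarrow> norm (g i x) \<le> B"
  shows "(LINT \<omega>|M. (\<Prod>i<n. g i (Y' (T (t (Suc i)) \<omega>) \<omega> - Y' (T (t i) \<omega>) \<omega>))) =
    (\<Prod>i<n. increment_mean M T (\<lambda>x. increment_mean M Y (g i) \<bar>x\<bar>) (t (Suc i) - t i))"
proof -
  interpret prob_space M using levy_process_prob_space[OF Y] .
  have T: "levy_process M T" and pos: "\<And>r \<omega>. 0 \<le> r \<Longrightarrow> \<omega> \<in> space M \<Longrightarrow> 0 \<le> T r \<omega>"
    using P by (auto simp: positive_levy_process_def)
  have Y'm: "\<And>q. 0 \<le> q \<Longrightarrow> Y' q \<in> borel_measurable M"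
    and Y'Y: "\<And>q. 0 \<le> q \<Longrightarrow> AE \<omega> in M. Y' q \<omega> = Y q \<omega>"
    and rc: "\<And>\<omega> q. \<omega> \<in> space M \<Longrightarrow> 0 \<le> q \<Longrightarrow> continuous (at_right q) (\<lambda>s. Y' s \<omega>)"
    using rcm by (auto simp: right_continuous_modification_def real_process_def)
  note Tm = levy_process_measurable[OF T t]
  note Ym = levy_process_measurable[OF Y]
  have gm: "g i \<in> borel_measurable borel" if "i < n" for i
    using g[OF that] by (rule uniformly_continuous_imp_borel_measurable)
  define G where "G = (\<lambda>i x. increment_mean M Y (g i) \<bar>x\<bar>)"
  have Guc: "uniformly_continuous_on UNIV (G i)" if "i < n" for i
    unfolding G_def by (rule increment_mean_abs_uniformly_continuous[OF Y g[OF that] B[OF that]])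
  have Gm: "G i \<in> borel_measurable borel" if "i < n" for i
    using Guc[OF that] by (rule uniformly_continuous_imp_borel_measurable)
  have GB: "norm (G i x) \<le> B" if "i < n" for i x
    unfolding G_def using that by (intro norm_increment_mean_le[OF Y] gm B) auto
  have gT: "(\<lambda>\<omega>. grid k (T (t i) \<omega>)) \<in> borel_measurable M" if "i \<le> n" for i k
    by (rule measurable_compose[OF Tm[OF that] grid_measurable])

  define L where "L = (\<lambda>k \<omega>. \<Prod>i<n. g i (Y' (grid k (T (t (Suc i)) \<omega>)) \<omega> - Y' (grid k (T (t i) \<omega>)) \<omega>))"
  define R where "R = (\<lambda>k \<omega>. \<Prod>i<n. G i (grid k (T (t (Suc i)) \<omega>) - grid k (T (t i) \<omega>)))"
  have Lm: "L k \<in> borel_measurable M" for k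
    unfolding L_def
    by (rule borel_measurable_increment_prod[where V="\<lambda>i \<omega>. Y' (grid k (T (t i) \<omega>)) \<omega>"])
       (auto intro!: gm grid_compose_measurable[OF _ Tm] Y'm)
  have Rm: "R k \<in> borel_measurable M" for k
    unfolding R_def
    by (rule borel_measurable_increment_prod[where V="\<lambda>i \<omega>. grid k (T (t i) \<omega>)"]) (auto intro: Gm gT)
  have "(\<lambda>k. LINT \<omega>|M. L k \<omega>) \<longlonglongrightarrow>
    (LINT \<omega>|M. (\<Prod>i<n. g i (Y' (T (t (Suc i)) \<omega>) \<omega> - Y' (T (t i) \<omega>) \<omega>)))"
  proof (rule integral_dominated_convergence[where w="\<lambda>_. B ^ n"])
    show "(\<lambda>\<omega>. \<Prod>i<n. g i (Y' (T (t (Suc i)) \<omega>) \<omega> - Y' (T (t i) \<omega>) \<omega>)) \<in> borel_measurable M"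
      by (rule borel_measurable_increment_prod[where V="\<lambda>i \<omega>. Y' (T (t i) \<omega>) \<omega>"])
         (use t pos rc in \<open>auto intro!: gm right_continuous_compose_measurable[OF _ Tm] Y'm\<close>)
    show "AE \<omega> in M. (\<lambda>k. L k \<omega>) \<longlonglongrightarrow> (\<Prod>i<n. g i (Y' (T (t (Suc i)) \<omega>) \<omega> - Y' (T (t i) \<omega>) \<omega>))"
      unfolding L_def
      by (intro AE_I2 tendsto_increment_prod[where W="\<lambda>i. Y' (T (t i) _) _"] g)
         (use t pos rc in \<open>auto intro!: right_continuous_grid_tendsto[where f="\<lambda>s. Y' s _"]\<close>)
    show "AE \<omega> in M. norm (L k \<omega>) \<le> B ^ n" for k
      unfolding L_def by (intro AE_I2 norm_prod_le_power B)
  qed (use Lm in auto)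
  moreover have "(\<lambda>k. LINT \<omega>|M. R k \<omega>) \<longlonglongrightarrow>
    (LINT \<omega>|M. (\<Prod>i<n. G i (T (t (Suc i)) \<omega> - T (t i) \<omega>)))"
  proof (rule integral_dominated_convergence[where w="\<lambda>_. B ^ n"])
    show "(\<lambda>\<omega>. \<Prod>i<n. G i (T (t (Suc i)) \<omega> - T (t i) \<omega>)) \<in> borel_measurable M"
      by (rule borel_measurable_increment_prod[where V="\<lambda>i \<omega>. T (t i) \<omega>"]) (auto intro: Gm Tm)
    show "AE \<omega> in M. (\<lambda>k. R k \<omega>) \<longlonglongrightarrow> (\<Prod>i<n. G i (T (t (Suc i)) \<omega> - T (t i) \<omega>))"
      unfolding R_def
      by (intro AE_I2 tendsto_increment_prod[where W="\<lambda>i. T (t i) _"] Guc)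
         (use t pos in \<open>auto intro!: grid_tendsto\<close>)
    show "AE \<omega> in M. norm (R k \<omega>) \<le> B ^ n" for k
      unfolding R_def by (intro AE_I2 norm_prod_le_power GB)
  qed (use Rm in auto)
  moreover have "(LINT \<omega>|M. L k \<omega>) = (LINT \<omega>|M. R k \<omega>)" for k
  proof -
    have "(LINT \<omega>|M. L k \<omega>) =
      (LINT \<omega>|M. (\<Prod>i<n. g i (Y (grid k (T (t (Suc i)) \<omega>)) \<omega> - Y (grid k (T (t i) \<omega>)) \<omega>)))"
    proof (rule integral_cong_AE[OF Lm])
      show "(\<lambda>\<omega>. \<Prod>i<n. g i (Y (grid k (T (t (Suc i)) \<omega>)) \<omega> - Y (grid k (T (t i) \<omega>)) \<omega>)) \<in> borel_measurable M"
        by (rule borel_measurable_increment_prod[where V="\<lambda>i \<omega>. Y (grid k (T (t i) \<omega>)) \<omega>"])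
           (auto intro!: gm grid_compose_measurable[OF _ Tm] Ym)
      \<comment> \<open>For fixed \<open>k\<close> there are countably many grid times, so a single
        null event carries all disagreements of \<open>Y'\<close> with \<open>Y\<close> on the
        grid.\<close>
      have "AE \<omega> in M. \<forall>m::nat. Y' ((real m + 1) / real (Suc k)) \<omega> = Y ((real m + 1) / real (Suc k)) \<omega>"
        by (subst AE_all_countable) (intro allI Y'Y, simp)
      then show "AE \<omega> in M. L k \<omega> = (\<Prod>i<n. g i (Y (grid k (T (t (Suc i)) \<omega>)) \<omega> - Y (grid k (T (t i) \<omega>)) \<omega>))"
        unfolding L_def grid_def by eventually_elim (simp del: of_nat_Suc)
    qed
    also have "\<dots> = (LINT \<omega>|M. R k \<omega>)"
      unfolding R_def G_def
      using Gm t mono by (intro grid_subordination_mean_prod[where B=B, OF Y T I] positive_levy_process_mono[OF P] gm B)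
        (auto simp: G_def)
    finally show ?thesis .
  qed
  ultimately have "(LINT \<omega>|M. (\<Prod>i<n. g i (Y' (T (t (Suc i)) \<omega>) \<omega> - Y' (T (t i) \<omega>) \<omega>))) =
    (LINT \<omega>|M. (\<Prod>i<n. G i (T (t (Suc i)) \<omega> - T (t i) \<omega>)))"
    using LIMSEQ_unique by simp
  also have "\<dots> = (\<Prod>i<n. increment_mean M T (G i) (t (Suc i) - t i))"
    using t mono by (intro levy_increment_mean_prod[where B=B, OF T] Gm GB) auto
  finally show ?thesis by (simp add: G_def)
qed

section \<open>Transfer to \<open>X\<close> through finite-dimensional distributions\<close>

lemma equal_in_distribution_integral:
  fixes h :: "(real \<Rightarrow> real) \<Rightarrow> 'b::{banach, second_countable_topology}"
  assumes eq: "equal_in_distribution N X M Z"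
    and X: "\<And>t. 0 \<le> t \<Longrightarrow> X t \<in> borel_measurable N" and Z: "\<And>t. 0 \<le> t \<Longrightarrow> Z t \<in> borel_measurable M"
    and J: "finite J" "J \<subseteq> {0..}" and [measurable]: "h \<in> borel_measurable (PiM J (\<lambda>_. borel))"
  shows "(LINT \<omega>|N. h (\<lambda>t\<in>J. X t \<omega>)) = (LINT \<omega>|M. h (\<lambda>t\<in>J. Z t \<omega>))"
proof -
  have [measurable]: "(\<lambda>\<omega>. \<lambda>t\<in>J. X t \<omega>) \<in> measurable N (PiM J (\<lambda>_. borel))"
       "(\<lambda>\<omega>. \<lambda>t\<in>J. Z t \<omega>) \<in> measurable M (PiM J (\<lambda>_. borel))"
    using J X Z by (auto intro!: measurable_restrict)
  have "(LINT \<omega>|N. h (\<lambda>t\<in>J. X t \<omega>)) = (LINT y|distr N (PiM J (\<lambda>_. borel)) (\<lambda>\<omega>. \<lambda>t\<in>J. X t \<omega>). h y)"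
    by (subst integral_distr) auto
  also have "\<dots> = (LINT y|distr M (PiM J (\<lambda>_. borel)) (\<lambda>\<omega>. \<lambda>t\<in>J. Z t \<omega>). h y)"
    using eq J unfolding equal_in_distribution_def by simp
  also have "\<dots> = (LINT \<omega>|M. h (\<lambda>t\<in>J. Z t \<omega>))"
    by (subst integral_distr) auto
  finally show ?thesis .
qed

text \<open>Finitely many increments are a measurable function of the values at finitely many times,
  so the mean may be computed for the composed process instead of \<open>X\<close>.\<close>

lemma subordinated_mean_prod:
  fixes g :: "nat \<Rightarrow> real \<Rightarrow> 'b::{real_normed_field, banach, second_countable_topology}"
  assumes S: "subordinated N X M Y T"
    and t0: "0 \<le> t 0" and mono: "\<And>i. i < n \<Longrightarrow> t i \<le> t (Suc i)"
    and g: "\<And>i. i < n \<Longrightarrow> uniformly_continuous_on UNIV (g i)"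
    and B: "\<And>i x. i < n \<Longrightarrow> norm (g i x) \<le> B"
  shows "(LINT \<omega>|N. (\<Prod>i<n. g i (X (t (Suc i)) \<omega> - X (t i) \<omega>))) =
    (\<Prod>i<n. increment_mean M T (\<lambda>x. increment_mean M Y (g i) \<bar>x\<bar>) (t (Suc i) - t i))"
proof -
  have Y: "levy_process M Y" and P: "positive_levy_process M T" and I: "independent_processes M Y T"
    and Xm: "\<And>r. 0 \<le> r \<Longrightarrow> X r \<in> borel_measurable N"
    using S by (auto simp: subordinated_def real_process_def)
  obtain Y' where rcm: "right_continuous_modification M Y Y'"
    and eq: "equal_in_distribution N X M (\<lambda>t \<omega>. Y' (T t \<omega>) \<omega>)"
    using S by (auto simp: subordinated_def)
  have Zm: "(\<lambda>\<omega>. Y' (T r \<omega>) \<omega>) \<in> borel_measurable M" if "0 \<le> r" for r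
    using rcm P levy_process_measurable[of M T r] that
    by (intro right_continuous_compose_measurable[where Z=Y' and V="T r"])
       (auto simp: right_continuous_modification_def real_process_def positive_levy_process_def)
  have t: "0 \<le> t i" if "i \<le> n" for i
    using that
  proof (induction i)
    case (Suc i)
    then show ?case using mono[of i] by simp
  qed (simp add: t0)
  \<comment> \<open>The last index \<open>n\<close> is included because increment
    \<open>n - 1\<close> ends at \<open>t n\<close>. Coordinates are indexed by the times
    themselves, so repeated times are harmless.\<close>
  define J where "J = t ` {..n}"
  define h where "h = (\<lambda>y. \<Prod>i<n. g i (y (t (Suc i)) - y (t i)))"
  have hm: "h \<in> borel_measurable (PiM J (\<lambda>_. borel))"
    unfolding h_def
    by (rule borel_measurable_increment_prod[where V="\<lambda>i y. y (t i)"])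
       (auto simp: J_def intro!: uniformly_continuous_imp_borel_measurable g measurable_component_singleton)
  have hr: "h (\<lambda>r\<in>J. V r) = (\<Prod>i<n. g i (V (t (Suc i)) - V (t i)))" for V
    unfolding h_def by (intro prod.cong refl) (auto simp: J_def)
  have "(LINT \<omega>|N. h (\<lambda>r\<in>J. X r \<omega>)) = (LINT \<omega>|M. h (\<lambda>r\<in>J. Y' (T r \<omega>) \<omega>))"
    using t by (intro equal_in_distribution_integral[OF eq Xm Zm _ _ hm]) (auto simp: J_def)
  then show ?thesis
    unfolding hr using subordination_mean_prod[where g=g and t=t and n=n and B=B, OF Y P I rcm t mono g B] by simp
qed

lemma subordinated_mean:
  fixes g :: "real \<Rightarrow> 'b::{real_normed_field, banach, second_countable_topology}"
  assumes "subordinated N X M Y T" and "0 \<le> s" "s \<le> t"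
    and "uniformly_continuous_on UNIV g" and "\<And>x. norm (g x) \<le> B"
  shows "(LINT \<omega>|N. g (X t \<omega> - X s \<omega>)) =
    increment_mean M T (\<lambda>x. increment_mean M Y g \<bar>x\<bar>) (t - s)"
  using subordinated_mean_prod[OF assms(1), where t="\<lambda>i. if i = 0 then s else t" and n=1 and g="\<lambda>_. g" and B=B]
    assms(2-) by (simp add: lessThan_Suc)


section \<open>A subordinated process is a Levy process\<close>

lemma cts_step_tendsto_indicator:
  "(\<lambda>k. cts_step x (x + 1 / real (Suc k)) y) \<longlonglongrightarrow> (indicator {..x} y :: real)"
proof (cases "y \<le> x")
  case False
  have "(\<lambda>k. x + 1 / real (Suc k)) \<longlonglongrightarrow> x + 0"
    by (intro tendsto_add tendsto_const LIMSEQ_Suc[OF lim_1_over_n])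
  then have "\<forall>\<^sub>F k in sequentially. x + 1 / real (Suc k) < y"
    using False by (intro order_tendstoD) auto
  then have "\<forall>\<^sub>F k in sequentially. cts_step x (x + 1 / real (Suc k)) y = indicator {..x} y"
    by eventually_elim (use False in \<open>auto simp: cts_step_def\<close>)
  then show ?thesis by (rule tendsto_eventually)
qed (simp add: cts_step_def)

lemma cts_step_bounds: "a < b \<Longrightarrow> 0 \<le> cts_step a b x" "a < b \<Longrightarrow> cts_step a b x \<le> 1"
  by (auto simp: cts_step_def field_simps)

text \<open>Closed half-lines form an intersection-stable generator of the Borel sets, and their
  indicators are limits of uniformly continuous functions with values in [0,1]. Dominated
  convergence carries the product formula over to events.\<close>

lemma (in prob_space) indep_vars_if_mean_prod:
  fixes W :: "nat \<Rightarrow> 'a \<Rightarrow> real"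
  assumes W: "\<And>i. i < n \<Longrightarrow> W i \<in> borel_measurable M"
    and prod: "\<And>g :: nat \<Rightarrow> real \<Rightarrow> real.
       (\<And>i. i < n \<Longrightarrow> uniformly_continuous_on UNIV (g i)) \<Longrightarrow> (\<And>i x. i < n \<Longrightarrow> norm (g i x) \<le> 1) \<Longrightarrow>
       expectation (\<lambda>\<omega>. \<Prod>i<n. g i (W i \<omega>)) = (\<Prod>i<n. expectation (\<lambda>\<omega>. g i (W i \<omega>)))"
  shows "indep_vars (\<lambda>_. borel) W {..<n}"
proof (cases "n = 0")
  case True
  then show ?thesis by (simp add: indep_vars_def indep_sets_def)
next
  case False
  \<comment> \<open>The criterion \<open>indep_vars_finite\<close> asks for a nonempty index set and
    for a generator containing the whole space; hence the split on \<open>n\<close> and the added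
    \<open>UNIV\<close>.\<close>
  define E where "E = insert UNIV (range (atMost :: real \<Rightarrow> real set))"
  have approx: "\<exists>g. (\<forall>k. uniformly_continuous_on UNIV (g k) \<and> (\<forall>x. norm (g k x) \<le> 1)) \<and>
      (\<forall>x. (\<lambda>k. g k x) \<longlonglongrightarrow> (indicator A x :: real))" if A: "A \<in> E" for A
  proof (cases "A = UNIV")
    case True
    then show ?thesis by (intro exI[of _ "\<lambda>_ _. 1"]) (auto intro: uniformly_continuous_on_const)
  next
    case False
    then obtain x where x: "A = {..x}" using A by (auto simp: E_def)
    show ?thesis
      unfolding x using cts_step_bounds
      by (intro exI[of _ "\<lambda>k. cts_step x (x + 1 / real (Suc k))"])
         (auto simp: cts_step_tendsto_indicator abs_le_iff simp del: of_nat_Suc intro!: cts_step_uniformly_continuous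
               intro: order_trans[of _ 0])
  qed
  have "indep_vars (\<lambda>_. borel) W {..<n} \<longleftrightarrow> (\<forall>A\<in>{..<n} \<rightarrow> E.
     prob (\<Inter>j\<in>{..<n}. W j -` A j \<inter> space M) = (\<Prod>j\<in>{..<n}. prob (W j -` A j \<inter> space M)))"
  proof (rule indep_vars_finite)
    have "sets borel = sigma_sets UNIV (range (atMost :: real \<Rightarrow> real set))"
      by (subst borel_eq_atMost) (simp add: sets_measure_of)
    also have "\<dots> = sigma_sets UNIV E"
      unfolding E_def
      by (rule sigma_sets_eqI) (auto intro: sigma_sets_top)
    finally show "sets borel = sigma_sets (space (borel :: real measure)) E" by simp
    show "Int_stable E"
      by (auto simp: Int_stable_def E_def)
  qed (use False W in \<open>auto simp: E_def\<close>)
  moreover have "prob (\<Inter>j\<in>{..<n}. W j -` A j \<inter> space M) = (\<Prod>j\<in>{..<n}. prob (W j -` A j \<inter> space M))"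
    if A: "A \<in> {..<n} \<rightarrow> E" for A
  proof -
    have "\<forall>i\<in>{..<n}. \<exists>g. (\<forall>k. uniformly_continuous_on UNIV (g k) \<and> (\<forall>x. norm (g k x) \<le> 1)) \<and>
      (\<forall>x. (\<lambda>k. g k x) \<longlonglongrightarrow> (indicator (A i) x :: real))"
      using A by (intro ballI approx) auto
    then obtain g :: "nat \<Rightarrow> nat \<Rightarrow> real \<Rightarrow> real" where
      uc: "\<And>i k. i < n \<Longrightarrow> uniformly_continuous_on UNIV (g i k)"
      and g1: "\<And>i k x. i < n \<Longrightarrow> norm (g i k x) \<le> 1"
      and lim: "\<And>i x. i < n \<Longrightarrow> (\<lambda>k. g i k x) \<longlonglongrightarrow> indicator (A i) x"
      by (metis lessThan_iff)
    have gW: "(\<lambda>\<omega>. g i k (W i \<omega>)) \<in> borel_measurable M" if "i < n" for i k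
      by (rule measurable_compose[OF W[OF that] uniformly_continuous_imp_borel_measurable[OF uc[OF that]]])
    have AS: "A i \<in> sets borel" if "i < n" for i
    proof -
      have "A i \<in> E" using A that by auto
      then show ?thesis by (auto simp: E_def)
    qed
    have WA: "W i -` A i \<inter> space M \<in> sets M" if "i < n" for i
      using W[OF that] AS[OF that] by (rule measurable_sets)
    have ind: "(\<lambda>\<omega>. indicator (A i) (W i \<omega>) :: real) \<in> borel_measurable M" if "i < n" for i
      by (rule measurable_compose[OF W[OF that] borel_measurable_indicator[OF AS[OF that]]])
    have "(\<lambda>k. expectation (\<lambda>\<omega>. \<Prod>i<n. g i k (W i \<omega>))) \<longlonglongrightarrow>
        expectation (\<lambda>\<omega>. \<Prod>i<n. indicator (A i) (W i \<omega>))"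
    proof (rule integral_dominated_convergence[where w="\<lambda>_. 1 ^ n"])
      show "AE \<omega> in M. norm (\<Prod>i<n. g i k (W i \<omega>)) \<le> 1 ^ n" for k
        by (intro AE_I2 norm_prod_le_power g1)
      show "AE \<omega> in M. (\<lambda>k. \<Prod>i<n. g i k (W i \<omega>)) \<longlonglongrightarrow> (\<Prod>i<n. indicator (A i) (W i \<omega>))"
        by (intro AE_I2 tendsto_prod lim) auto
    qed (auto intro!: borel_measurable_prod gW ind)
    moreover have "(\<lambda>k. \<Prod>i<n. expectation (\<lambda>\<omega>. g i k (W i \<omega>))) \<longlonglongrightarrow>
        (\<Prod>i<n. expectation (\<lambda>\<omega>. indicator (A i) (W i \<omega>)))"
    proof (rule tendsto_prod)
      fix i assume "i \<in> {..<n}"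
      then have i: "i < n" by simp
      show "(\<lambda>k. expectation (\<lambda>\<omega>. g i k (W i \<omega>))) \<longlonglongrightarrow> expectation (\<lambda>\<omega>. indicator (A i) (W i \<omega>))"
        by (rule integral_dominated_convergence[where w="\<lambda>_. 1"])
           (use i g1 lim gW ind in auto)
    qed
    moreover have "expectation (\<lambda>\<omega>. \<Prod>i<n. g i k (W i \<omega>)) = (\<Prod>i<n. expectation (\<lambda>\<omega>. g i k (W i \<omega>)))" for k
      using uc g1 by (intro prod) auto
    ultimately have eq: "expectation (\<lambda>\<omega>. \<Prod>i<n. indicator (A i) (W i \<omega>)) =
        (\<Prod>i<n. expectation (\<lambda>\<omega>. indicator (A i) (W i \<omega>) :: real))"
      using LIMSEQ_unique by simp
    have "expectation (\<lambda>\<omega>. \<Prod>i<n. indicator (A i) (W i \<omega>)) =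
        expectation (indicator (\<Inter>j\<in>{..<n}. W j -` A j \<inter> space M) :: _ \<Rightarrow> real)"
    proof (rule Bochner_Integration.integral_cong[OF refl])
      fix \<omega> assume \<omega>: "\<omega> \<in> space M"
      show "(\<Prod>i<n. indicator (A i) (W i \<omega>)) = (indicator (\<Inter>j\<in>{..<n}. W j -` A j \<inter> space M) \<omega> :: real)"
      proof (cases "\<forall>i<n. W i \<omega> \<in> A i")
        case True
        then show ?thesis using \<omega> by (simp add: indicator_def)
      next
        case False
        then have "(\<Prod>i<n. indicator (A i) (W i \<omega>) :: real) = 0"
          by (intro prod_zero) (auto simp: indicator_def)
        then show ?thesis using False by (auto simp: indicator_def)
      qed
    qed
    also have "\<dots> = prob (\<Inter>j\<in>{..<n}. W j -` A j \<inter> space M)"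
    proof -
      \<comment> \<open>An intersection over no indices would be \<open>UNIV\<close> rather than
        \<open>space M\<close>; \<open>n\<close> is nonzero in this branch.\<close>
      have "(\<Inter>j\<in>{..<n}. W j -` A j \<inter> space M) \<subseteq> space M" using False by auto
      then show ?thesis by (simp add: Int_absorb2)
    qed
    finally have l: "expectation (\<lambda>\<omega>. \<Prod>i<n. indicator (A i) (W i \<omega>)) = prob (\<Inter>j\<in>{..<n}. W j -` A j \<inter> space M)" .
    have r: "expectation (\<lambda>\<omega>. indicator (A i) (W i \<omega>)) = prob (W i -` A i \<inter> space M)" if "i < n" for i
    proof -
      have "expectation (\<lambda>\<omega>. indicator (A i) (W i \<omega>)) = expectation (indicator (W i -` A i \<inter> space M) :: _ \<Rightarrow> real)"
        by (rule Bochner_Integration.integral_cong[OF refl]) (auto simp: indicator_def)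
      then show ?thesis using WA[OF that] by (simp add: emeasure_eq_measure)
    qed
    show ?thesis using eq l r by simp
  qed
  ultimately show ?thesis by blast
qed

text \<open>The event concerns the law at time 0 alone, so it transfers from
  \<open>Y' (T 0)\<close>. There it follows from the almost sure equalities for \<open>T 0\<close>,
  \<open>Y' 0\<close> and \<open>Y 0\<close>.\<close>

lemma subordinated_start:
  assumes S: "subordinated N X M Y T"
  shows "AE \<omega> in N. X 0 \<omega> = 0"
proof -
  have Y: "levy_process M Y" and P: "positive_levy_process M T"
    and Xm: "X 0 \<in> borel_measurable N"
    using S by (auto simp: subordinated_def real_process_def)
  obtain Y' where rcm: "right_continuous_modification M Y Y'"
    and eq: "equal_in_distribution N X M (\<lambda>t \<omega>. Y' (T t \<omega>) \<omega>)"
    using S by (auto simp: subordinated_def)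
  have Zm: "(\<lambda>\<omega>. Y' (T 0 \<omega>) \<omega>) \<in> borel_measurable M"
    using rcm P levy_process_measurable[of M T 0]
    by (intro right_continuous_compose_measurable[where Z=Y' and V="T 0"])
       (auto simp: right_continuous_modification_def real_process_def positive_levy_process_def)
  have "AE \<omega> in M. T 0 \<omega> = 0" "AE \<omega> in M. Y 0 \<omega> = 0" "AE \<omega> in M. Y' 0 \<omega> = Y 0 \<omega>"
    using P Y rcm by (auto simp: positive_levy_process_def levy_process_def right_continuous_modification_def)
  then have Z: "AE \<omega> in M. Y' (T 0 \<omega>) \<omega> = 0"
    by eventually_elim simp
  let ?S = "PiM {0::real} (\<lambda>_. borel :: real measure)"
  have ms: "{y \<in> space ?S. y 0 = 0} \<in> sets ?S"
  proof -
    have [measurable]: "(\<lambda>y. y 0) \<in> borel_measurable ?S" by (rule measurable_component_singleton) simp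
    show ?thesis by measurable
  qed
  have Xr: "(\<lambda>\<omega>. \<lambda>t\<in>{0}. X t \<omega>) \<in> measurable N ?S" and Zr: "(\<lambda>\<omega>. \<lambda>t\<in>{0}. Y' (T t \<omega>) \<omega>) \<in> measurable M ?S"
    using Xm Zm by (auto intro!: measurable_restrict)
  have "AE y in distr M ?S (\<lambda>\<omega>. \<lambda>t\<in>{0}. Y' (T t \<omega>) \<omega>). y 0 = 0"
    using Z by (subst AE_distr_iff[OF Zr ms]) simp
  moreover have "distr N ?S (\<lambda>\<omega>. \<lambda>t\<in>{0}. X t \<omega>) = distr M ?S (\<lambda>\<omega>. \<lambda>t\<in>{0}. Y' (T t \<omega>) \<omega>)"
    using eq by (simp add: equal_in_distribution_def)
  ultimately have "AE y in distr N ?S (\<lambda>\<omega>. \<lambda>t\<in>{0}. X t \<omega>). y 0 = 0"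
    by (simp only:)
  then show ?thesis
    by (subst (asm) AE_distr_iff[OF Xr ms]) simp
qed

lemma increment_mean_zero:
  assumes "prob_space M"
  shows "increment_mean M W g 0 = g 0"
  unfolding increment_mean_def using assms by (simp add: prob_space.prob_space)

text \<open>A tail probability is bounded by the mean of a continuous majorant \<open>g\<close> of
  the tail indicator. That mean is a continuous function \<open>Q\<close> of the time difference,
  and it vanishes at 0 because \<open>g 0 = 0\<close>.\<close>

lemma subordinated_stochastically_continuous:
  assumes S: "subordinated N X M Y T"
  shows "stochastically_continuous N X"
  unfolding stochastically_continuous_def
proof (intro allI impI)
  fix t \<epsilon> :: real assume t: "0 \<le> t" and \<epsilon>: "0 < \<epsilon>"
  have Y: "levy_process M Y" and T: "levy_process M T"
    and N: "prob_space N" and Xm: "\<And>r. 0 \<le> r \<Longrightarrow> X r \<in> borel_measurable N"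
    using S by (auto simp: subordinated_def real_process_def positive_levy_process_def)
  interpret prob_space N by (rule N)
  \<comment> \<open>This function is 0 up to distance \<open>\<epsilon> / 2\<close> from the origin
    and 1 from distance \<open>\<epsilon>\<close> on. It is even, which covers both orders of
    \<open>s\<close> and \<open>t\<close>.\<close>
  define g :: "real \<Rightarrow> real" where "g = (\<lambda>x. 1 - cts_step (\<epsilon> / 2) \<epsilon> \<bar>x\<bar>)"
  have "uniformly_continuous_on {0..} (cts_step (\<epsilon> / 2) \<epsilon>)"
    using cts_step_uniformly_continuous[of "\<epsilon> / 2" \<epsilon>] \<epsilon>
    unfolding uniformly_continuous_on_def by (metis UNIV_I field_sum_of_halves less_add_same_cancel1 half_gt_zero)
  then have guc: "uniformly_continuous_on UNIV g"
    unfolding g_def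
    by (intro uniformly_continuous_on_diff uniformly_continuous_on_const uniformly_continuous_on_compose_abs)
  have g01: "0 \<le> g x" "g x \<le> 1" for x
    using cts_step_bounds[of "\<epsilon> / 2" \<epsilon> "\<bar>x\<bar>"] \<epsilon> by (auto simp: g_def)
  have gn: "norm (g x) \<le> 1" for x using g01[of x] by simp
  have gm: "g \<in> borel_measurable borel"
    by (rule uniformly_continuous_imp_borel_measurable[OF guc])
  have geven: "g (- x) = g x" for x by (simp add: g_def)
  define Q where "Q = increment_mean M T (\<lambda>x. increment_mean M Y g \<bar>x\<bar>)"
  have Q0: "Q 0 = 0"
    unfolding Q_def using levy_process_prob_space[OF Y] \<epsilon>
    by (simp add: increment_mean_zero g_def cts_step_def)
  have Quc: "uniformly_continuous_on {0..} Q"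
    unfolding Q_def
    by (rule increment_mean_uniformly_continuous[OF T increment_mean_abs_uniformly_continuous[OF Y guc gn],
          where B=1], rule norm_increment_mean_le[OF Y _ gm gn]) simp
  have Q: "expectation (\<lambda>\<omega>. g (X s \<omega> - X t \<omega>)) = Q \<bar>s - t\<bar>" if s: "0 \<le> s" for s
  proof (cases "t \<le> s")
    case True
    then show ?thesis using subordinated_mean[OF S t True guc gn] by (simp add: Q_def)
  next
    case False
    have "g (X s \<omega> - X t \<omega>) = g (X t \<omega> - X s \<omega>)" for \<omega>
      using geven[of "X t \<omega> - X s \<omega>"] by simp
    then show ?thesis using subordinated_mean[OF S s _ guc gn, of t] False by (simp add: Q_def)
  qed
  have bound: "measure N {\<omega> \<in> space N. \<bar>X s \<omega> - X t \<omega>\<bar> > \<epsilon>} \<le> Q \<bar>s - t\<bar>" if s: "0 \<le> s" for s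
  proof -
    have [measurable]: "X s \<in> borel_measurable N" "X t \<in> borel_measurable N" using Xm s t by auto
    have gX: "(\<lambda>\<omega>. g (X s \<omega> - X t \<omega>)) \<in> borel_measurable N"
      by (rule measurable_compose[OF _ gm]) measurable
    have "measure N {\<omega> \<in> space N. \<bar>X s \<omega> - X t \<omega>\<bar> > \<epsilon>} =
        expectation (indicator {\<omega> \<in> space N. \<bar>X s \<omega> - X t \<omega>\<bar> > \<epsilon>})"
      by (simp add: Int_absorb1)
    also have "\<dots> \<le> expectation (\<lambda>\<omega>. g (X s \<omega> - X t \<omega>))"
    proof (rule integral_mono)
      show "integrable N (\<lambda>\<omega>. g (X s \<omega> - X t \<omega>))"
        by (rule integrable_const_bound[where B=1]) (use gn gX in auto)
      show "indicator {\<omega> \<in> space N. \<epsilon> < \<bar>X s \<omega> - X t \<omega>\<bar>} \<omega> \<le> g (X s \<omega> - X t \<omega>)" for \<omega>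
        using \<epsilon> g01 by (auto simp: indicator_def g_def cts_step_def)
    qed (simp add: emeasure_eq_measure)
    finally show ?thesis using Q[OF s] by simp
  qed
  have "continuous_on {0..} (\<lambda>s. Q \<bar>s - t\<bar>)"
    by (rule continuous_on_compose2[OF uniformly_continuous_imp_continuous[OF Quc]])
       (auto intro!: continuous_intros)
  then have lim: "((\<lambda>s. Q \<bar>s - t\<bar>) \<longlongrightarrow> 0) (at t within {0..})"
    using t Q0 by (auto simp: continuous_on_def dest!: bspec[of _ _ t])
  show "((\<lambda>s. measure N {\<omega> \<in> space N. \<bar>X s \<omega> - X t \<omega>\<bar> > \<epsilon>}) \<longlongrightarrow> 0) (at t within {0..})"
    by (rule tendsto_sandwich[OF _ _ tendsto_const lim]) (auto simp: eventually_at_filter bound)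
qed

text \<open>The map is Lipschitz with constant \<open>\<bar>u\<bar>\<close>. This admits complex
  exponentials as test functions in the mean identities.\<close>

lemma iexp_mult_uniformly_continuous: "uniformly_continuous_on UNIV (\<lambda>x. iexp (u * x))"
proof -
  have "dist (iexp (u * x)) (iexp (u * y)) \<le> \<bar>u\<bar> * dist x y" for x y
  proof -
    have "iexp (u * x) - iexp (u * y) = iexp (u * y) * (iexp (u * (x - y)) - 1)"
      by (simp add: algebra_simps flip: exp_add)
    then have "dist (iexp (u * x)) (iexp (u * y)) = norm (iexp (u * (x - y)) - 1)"
      by (simp add: dist_norm norm_mult)
    also have "\<dots> \<le> \<bar>u * (x - y)\<bar>"
      using iexp_approx1[of "u * (x - y)" 0] by simp
    finally show ?thesis by (simp add: abs_mult dist_real_def)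
  qed
  then have "\<bar>u\<bar>-lipschitz_on UNIV (\<lambda>x. iexp (u * x))"
    by (intro lipschitz_onI) auto
  then show ?thesis by (rule lipschitz_on_uniformly_continuous)
qed

lemma char_distr_increment:
  assumes "real_process N X" "0 \<le> s" "0 \<le> t"
  shows "char (distr N borel (\<lambda>\<omega>. X t \<omega> - X s \<omega>)) u = (LINT \<omega>|N. iexp (u * (X t \<omega> - X s \<omega>)))"
proof -
  have [measurable]: "X t \<in> borel_measurable N" "X s \<in> borel_measurable N"
    using assms by (auto simp: real_process_def)
  show ?thesis unfolding char_def by (subst integral_distr) auto
qed

text \<open>The mean of a test function of an increment of \<open>X\<close> depends only on the
  length of the time interval. Complex exponentials then give stationarity by uniqueness of
  characteristic functions; for real test functions the product identity gives independence.\<close>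

lemma subordinated_levy_process:
  assumes S: "subordinated N X M Y T"
  shows "levy_process N X"
proof -
  have rp: "real_process N X" using S by (simp add: subordinated_def)
  then have Xm: "\<And>r. 0 \<le> r \<Longrightarrow> X r \<in> borel_measurable N" by (simp add: real_process_def)
  interpret prob_space N using rp by (simp add: real_process_def)
  have rd: "real_distribution (distr N borel (\<lambda>\<omega>. X t \<omega> - X s \<omega>))" if "0 \<le> s" "0 \<le> t" for s t
    using Xm that by (intro real_distribution_distr borel_measurable_diff) auto
  have "stationary_increments N X"
    unfolding stationary_increments_def
  proof (intro allI impI Levy_uniqueness rd ext)
    fix s h u :: real assume sh: "0 \<le> s" "0 \<le> h"
    have "(LINT \<omega>|N. iexp (u * (X (s + h) \<omega> - X s \<omega>))) = (LINT \<omega>|N. iexp (u * (X h \<omega> - X 0 \<omega>)))"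
      using subordinated_mean[OF S _ _ iexp_mult_uniformly_continuous[of u], of s "s + h" 1]
        subordinated_mean[OF S _ _ iexp_mult_uniformly_continuous[of u], of 0 h 1] sh
      by (simp add: norm_exp_i_times)
    then show "char (distr N borel (\<lambda>\<omega>. X (s + h) \<omega> - X s \<omega>)) u = char (distr N borel (\<lambda>\<omega>. X h \<omega> - X 0 \<omega>)) u"
      using sh by (simp add: char_distr_increment[OF rp])
  qed auto
  moreover have "independent_increments N X"
    unfolding independent_increments_def
  proof (intro allI impI)
    fix n :: nat and t :: "nat \<Rightarrow> real"
    assume "0 \<le> t 0 \<and> (\<forall>i<n. t i \<le> t (Suc i))"
    then have t0: "0 \<le> t 0" and mono: "\<And>i. i < n \<Longrightarrow> t i \<le> t (Suc i)" by auto
    have t: "0 \<le> t i" if "i \<le> n" for i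
      using that
    proof (induction i)
      case (Suc i)
      then show ?case using mono[of i] by simp
    qed (simp add: t0)
    show "indep_vars (\<lambda>_. borel) (\<lambda>i \<omega>. X (t (Suc i)) \<omega> - X (t i) \<omega>) {..<n}"
    proof (rule indep_vars_if_mean_prod)
      show "(\<lambda>\<omega>. X (t (Suc i)) \<omega> - X (t i) \<omega>) \<in> borel_measurable N" if "i < n" for i
        using Xm t that by (intro borel_measurable_diff) auto
      fix g :: "nat \<Rightarrow> real \<Rightarrow> real"
      assume uc: "\<And>i. i < n \<Longrightarrow> uniformly_continuous_on UNIV (g i)" and g1: "\<And>i x. i < n \<Longrightarrow> norm (g i x) \<le> 1"
      have "(LINT \<omega>|N. g i (X (t (Suc i)) \<omega> - X (t i) \<omega>)) =
        increment_mean M T (\<lambda>x. increment_mean M Y (g i) \<bar>x\<bar>) (t (Suc i) - t i)" if "i < n" for i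
        using that t mono uc g1 by (intro subordinated_mean[OF S, where B=1]) auto
      then show "expectation (\<lambda>\<omega>. \<Prod>i<n. g i (X (t (Suc i)) \<omega> - X (t i) \<omega>)) =
         (\<Prod>i<n. expectation (\<lambda>\<omega>. g i (X (t (Suc i)) \<omega> - X (t i) \<omega>)))"
        using subordinated_mean_prod[where g=g and t=t and n=n and B=1, OF S t0 mono uc g1] by simp
    qed
  qed
  ultimately show ?thesis
    unfolding levy_process_def
    using rp subordinated_start[OF S] subordinated_stochastically_continuous[OF S] by blast
qed


section \<open>Characteristic exponents along a Levy process\<close>

lemma borel_measurable_iexp_mult: "(\<lambda>x. iexp (u * x)) \<in> borel_measurable borel"
  by (rule uniformly_continuous_imp_borel_measurable[OF iexp_mult_uniformly_continuous])

text \<open>The increment over \<open>n\<close> steps of length \<open>h\<close> telescopes, and its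
  exponential is a product over independent steps with equal laws.\<close>

lemma increment_mean_iexp_multiple:
  assumes L: "levy_process M W" and h: "0 \<le> h"
  shows "increment_mean M W (\<lambda>x. iexp (u * x)) (real n * h) = increment_mean M W (\<lambda>x. iexp (u * x)) h ^ n"
proof -
  have "(\<Prod>i<n. iexp (u * (W (real (Suc i) * h) \<omega> - W (real i * h) \<omega>))) = iexp (u * (W (real n * h) \<omega> - W 0 \<omega>))" for \<omega>
  proof (induction n)
    case (Suc n)
    then show ?case by (simp add: algebra_simps flip: exp_add)
  qed simp
  then have "increment_mean M W (\<lambda>x. iexp (u * x)) (real n * h) =
    (LINT \<omega>|M. (\<Prod>i<n. iexp (u * (W (real (Suc i) * h) \<omega> - W (real i * h) \<omega>))))"
    unfolding increment_mean_def by simp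
  also have "\<dots> = (\<Prod>i<n. increment_mean M W (\<lambda>x. iexp (u * x)) (real (Suc i) * h - real i * h))"
    using h
    by (intro levy_increment_mean_prod[where t="\<lambda>i. real i * h" and g="\<lambda>_ x. iexp (u * x)" and B=1, OF L]
          borel_measurable_iexp_mult) (auto simp: mult_right_mono)
  also have "\<dots> = increment_mean M W (\<lambda>x. iexp (u * x)) h ^ n"
    by (simp add: algebra_simps)
  finally show ?thesis .
qed

text \<open>The value at time 1 fixes the values at times \<open>1 / n\<close> up to roots of unity.
  Continuity in \<open>u\<close> selects the right root, powers reach all positive rational times,
  and continuity in time gives the rest.\<close>

lemma increment_mean_iexp_eq_exp:
  assumes L: "levy_process M W" and \<psi>: "characteristic_exponent (char (distr M borel (W 1))) \<psi>"
    and t: "0 \<le> t"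
  shows "increment_mean M W (\<lambda>x. iexp (u * x)) t = exp (- (\<psi> u * of_real t))"
proof -
  interpret prob_space M using levy_process_prob_space[OF L] .
  have rp: "real_process M W" and W0: "AE \<omega> in M. W 0 \<omega> = 0" using L by (auto simp: levy_process_def)
  have Wm: "W r \<in> borel_measurable M" if "0 \<le> r" for r using levy_process_measurable[OF L that] .
  define G where "G = (\<lambda>u. increment_mean M W (\<lambda>x. iexp (u * x)))"
  have \<psi>c: "continuous_on UNIV \<psi>" and \<psi>0: "\<psi> 0 = 0" and \<psi>1: "char (distr M borel (W 1)) u = exp (- \<psi> u)" for u
    using \<psi> by (auto simp: characteristic_exponent_def)
  have Gchar: "G u h = char (distr M borel (\<lambda>\<omega>. W h \<omega> - W 0 \<omega>)) u" if "0 \<le> h" for u h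
    using that by (simp add: G_def increment_mean_def char_distr_increment[OF rp])
  have Gcont: "continuous_on UNIV (\<lambda>u. G u h)" if "0 \<le> h" for h
  proof -
    interpret D: real_distribution "distr M borel (\<lambda>\<omega>. W h \<omega> - W 0 \<omega>)"
      using Wm that by (intro real_distribution_distr borel_measurable_diff) auto
    show ?thesis
      using D.isCont_char that by (simp add: Gchar continuous_at_imp_continuous_on)
  qed
  have G1: "G u 1 = exp (- \<psi> u)" for u
  proof -
    have "distr M borel (\<lambda>\<omega>. W 1 \<omega> - W 0 \<omega>) = distr M borel (W 1)"
      using W0 Wm[of 0] Wm[of 1] by (intro distr_cong_AE) auto
    then show ?thesis using Gchar[of 1 u] \<psi>1 by simp
  qed
  have root: "G u (1 / real n) = exp (- (\<psi> u / of_nat n))" if n: "n \<ge> 1" for u n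
  proof -
    \<comment> \<open>The quotient of two candidate \<open>n\<close>-th roots is a continuous
      function of \<open>u\<close> with values in the finite set of roots of unity. On the connected
      line it is constant, and at \<open>u = 0\<close> it equals 1.\<close>
    define \<phi> where "\<phi> = (\<lambda>u. G u (1 / real n) * exp (\<psi> u / of_nat n))"
    have "\<phi> v ^ n = 1" for v
    proof -
      have "G v (1 / real n) ^ n = G v 1"
        using increment_mean_iexp_multiple[OF L, of "1 / real n" v n] n by (simp add: G_def)
      moreover have "exp (\<psi> v / of_nat n) ^ n = exp (\<psi> v)"
        using n by (simp flip: exp_of_nat_mult)
      ultimately show ?thesis
        by (simp add: \<phi>_def power_mult_distrib G1 flip: exp_add)
    qed
    then have "range \<phi> \<subseteq> {z. z ^ n = 1}" by auto
    moreover have "finite {z :: complex. z ^ n = 1}" using n by (rule finite_roots_unity)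
    ultimately have "finite (range \<phi>)" by (rule finite_subset)
    moreover have "continuous_on UNIV \<phi>"
      unfolding \<phi>_def using n by (intro continuous_intros Gcont \<psi>c) auto
    ultimately have "\<phi> constant_on UNIV"
      by (intro continuous_finite_range_constant) auto
    then have "\<phi> u = \<phi> 0" by (auto simp: constant_on_def)
    also have "\<phi> 0 = 1" by (simp add: \<phi>_def G_def increment_mean_def \<psi>0 prob_space)
    finally show ?thesis
      unfolding \<phi>_def by (simp add: exp_minus field_simps)
  qed
  \<comment> \<open>Grid points are positive multiples of \<open>1 / Suc k\<close>, so the root
    formula raised to a power applies to them.\<close>
  have "G u (grid k t) = exp (- (\<psi> u * of_real (grid k t)))" for k
  proof -
    define m where "m = Suc (nat \<lfloor>real (Suc k) * t\<rfloor>)"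
    have gr: "grid k t = real m * (1 / real (Suc k))" by (simp add: grid_def m_def)
    have "G u (grid k t) = exp (- (\<psi> u / of_nat (Suc k))) ^ m"
      unfolding gr using increment_mean_iexp_multiple[OF L, of "1 / real (Suc k)" u m] root[of "Suc k" u]
      by (simp add: G_def)
    also have "\<dots> = exp (- (\<psi> u * of_real (grid k t)))"
      unfolding gr by (simp add: field_simps flip: exp_of_nat_mult)
    finally show ?thesis .
  qed
  moreover have "(\<lambda>k. G u (grid k t)) \<longlonglongrightarrow> G u t"
  proof -
    have "continuous_on {0..} (G u)"
      unfolding G_def
      by (rule uniformly_continuous_imp_continuous[OF increment_mean_uniformly_continuous[where B=1, OF L
            iexp_mult_uniformly_continuous]]) simp
    from continuous_on_tendsto_compose[OF this grid_tendsto[OF t]]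
    show ?thesis using t less_imp_le[OF grid_pos] by simp
  qed
  moreover have "(\<lambda>k. exp (- (\<psi> u * of_real (grid k t)))) \<longlonglongrightarrow> exp (- (\<psi> u * of_real t))"
    by (intro tendsto_intros grid_tendsto t)
  ultimately show ?thesis
    using LIMSEQ_unique unfolding G_def by simp
qed

text \<open>A characteristic function is bounded by 1 in norm. This places the exponent in the half
  plane where Laplace transforms of laws on the half-line converge.\<close>

lemma characteristic_exponent_Re_nonneg:
  assumes L: "levy_process M W" and \<psi>: "characteristic_exponent (char (distr M borel (W 1))) \<psi>"
  shows "0 \<le> Re (\<psi> u)"
proof -
  have "norm (increment_mean M W (\<lambda>x. iexp (u * x)) 1) \<le> 1"
    by (rule norm_increment_mean_le[OF L _ borel_measurable_iexp_mult]) auto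
  then show ?thesis
    unfolding increment_mean_iexp_eq_exp[OF L \<psi> zero_le_one] by simp
qed


section \<open>Laplace transforms\<close>

text \<open>Complex arguments are required because the transform is evaluated at
  \<open>\<psi> u\<close>. For a law on the half-line the integrand is bounded by 1 when
  \<open>0 \<le> Re z\<close>; outside that half plane the integral may take its default value
  0.\<close>

definition laplace_mean :: "real measure \<Rightarrow> complex \<Rightarrow> complex" where
  "laplace_mean \<mu> z = (LINT x|\<mu>. exp (- (z * of_real x)))"

lemma laplace_mean_of_real: "laplace_mean \<mu> (of_real s) = of_real (laplace_transform \<mu> s)"
proof -
  have "exp (- (of_real s * of_real x)) = complex_of_real (exp (- (s * x)))" for x
    by (simp flip: exp_of_real)
  then show ?thesis
    unfolding laplace_mean_def laplace_transform_def by (simp flip: integral_complex_of_real)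
qed

lemma nonneg_distribution_AE_norm_exp:
  assumes "nonneg_distribution \<mu>" "0 \<le> Re z"
  shows "AE x in \<mu>. norm (exp (- (z * of_real x))) \<le> 1"
proof -
  have "AE x in \<mu>. 0 \<le> x" using assms by (simp add: nonneg_distribution_def)
  then show ?thesis by eventually_elim (use assms(2) in simp)
qed

section \<open>Laws of a scaled variable plus an independent one\<close>

lemma AE_pair_nonneg:
  assumes \<mu>: "nonneg_distribution \<mu>" and \<nu>: "nonneg_distribution \<nu>"
  shows "AE p in (\<mu> \<Otimes>\<^sub>M \<nu>). 0 \<le> fst p \<and> 0 \<le> snd p"
proof -
  interpret M: real_distribution \<mu> using \<mu> by (simp add: nonneg_distribution_def)
  interpret N: real_distribution \<nu> using \<nu> by (simp add: nonneg_distribution_def)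
  interpret P: pair_prob_space \<mu> \<nu> ..
  have x: "AE x in \<mu>. 0 \<le> x" and v: "AE v in \<nu>. 0 \<le> v"
    using \<mu> \<nu> by (auto simp: nonneg_distribution_def)
  show ?thesis
  proof (rule P.AE_pair_measure)
    show "{p \<in> space (\<mu> \<Otimes>\<^sub>M \<nu>). 0 \<le> fst p \<and> 0 \<le> snd p} \<in> sets (\<mu> \<Otimes>\<^sub>M \<nu>)"
      by measurable
    show "AE x in \<mu>. AE v in \<nu>. 0 \<le> fst (x, v) \<and> 0 \<le> snd (x, v)"
      using x by eventually_elim (use v in auto)
  qed
qed

lemma nonneg_distribution_convolution:
  assumes \<mu>: "nonneg_distribution \<mu>" and \<nu>: "nonneg_distribution \<nu>" and c: "0 \<le> c"
  shows "nonneg_distribution (distr (\<mu> \<Otimes>\<^sub>M \<nu>) borel (\<lambda>p. c * fst p + snd p))"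
proof -
  interpret M: real_distribution \<mu> using \<mu> by (simp add: nonneg_distribution_def)
  interpret N: real_distribution \<nu> using \<nu> by (simp add: nonneg_distribution_def)
  interpret P: pair_prob_space \<mu> \<nu> ..
  have [measurable]: "(\<lambda>p. c * fst p + snd p) \<in> borel_measurable (\<mu> \<Otimes>\<^sub>M \<nu>)"
    by measurable
  have "AE p in (\<mu> \<Otimes>\<^sub>M \<nu>). 0 \<le> c * fst p + snd p"
    using AE_pair_nonneg[OF \<mu> \<nu>] by eventually_elim (use c in simp)
  then have "AE y in distr (\<mu> \<Otimes>\<^sub>M \<nu>) borel (\<lambda>p. c * fst p + snd p). 0 \<le> y"
    by (subst AE_distr_iff) auto
  then show ?thesis
    unfolding nonneg_distribution_def by (auto intro: P.real_distribution_distr)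
qed

lemma laplace_mean_convolution:
  assumes \<mu>: "nonneg_distribution \<mu>" and \<nu>: "nonneg_distribution \<nu>" and c: "0 \<le> c" and z: "0 \<le> Re z"
  shows "laplace_mean (distr (\<mu> \<Otimes>\<^sub>M \<nu>) borel (\<lambda>p. c * fst p + snd p)) z =
    laplace_mean \<mu> (of_real c * z) * laplace_mean \<nu> z"
proof -
  interpret M: real_distribution \<mu> using \<mu> by (simp add: nonneg_distribution_def)
  interpret N: real_distribution \<nu> using \<nu> by (simp add: nonneg_distribution_def)
  interpret P: pair_prob_space \<mu> \<nu> ..
  have [measurable]: "(\<lambda>p. c * fst p + snd p) \<in> borel_measurable (\<mu> \<Otimes>\<^sub>M \<nu>)"
    by measurable
  have expm[measurable]: "(\<lambda>x. exp (- (w * of_real x))) \<in> borel_measurable borel" for w :: complex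
    by (intro borel_measurable_continuous_onI continuous_intros)
  define F where "F = (\<lambda>p. exp (- (of_real c * z * of_real (fst p))) * exp (- (z * of_real (snd p))))"
  have Fm: "F \<in> borel_measurable (\<mu> \<Otimes>\<^sub>M \<nu>)"
    unfolding F_def by measurable
  have int: "integrable (\<mu> \<Otimes>\<^sub>M \<nu>) F"
  proof (rule P.integrable_const_bound[OF _ Fm, where B=1])
    show "AE p in (\<mu> \<Otimes>\<^sub>M \<nu>). norm (F p) \<le> 1"
      using AE_pair_nonneg[OF \<mu> \<nu>]
      by eventually_elim (use c z in \<open>simp add: F_def norm_mult mult_le_one\<close>)
  qed
  have "laplace_mean (distr (\<mu> \<Otimes>\<^sub>M \<nu>) borel (\<lambda>p. c * fst p + snd p)) z = (LINT p|(\<mu> \<Otimes>\<^sub>M \<nu>). F p)"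
    unfolding laplace_mean_def F_def
    by (subst integral_distr) (auto simp: algebra_simps simp flip: exp_add)
  also have "\<dots> = (LINT x|\<mu>. LINT v|\<nu>. F (x, v))"
    by (rule P.integral_fst'[OF int, symmetric])
  also have "\<dots> = laplace_mean \<mu> (of_real c * z) * laplace_mean \<nu> z"
    by (simp add: F_def laplace_mean_def)
  finally show ?thesis .
qed

text \<open>The substitution \<open>y = exp (- x)\<close> turns the transforms at integers into
  moments of laws on [0,1]. Weierstrass approximation extends equality of moments to continuous
  functions; cosine and sine then give equal characteristic functions of the image laws.\<close>

lemma laplace_transform_unique:
  assumes \<mu>: "nonneg_distribution \<mu>" and \<nu>: "nonneg_distribution \<nu>"
    and eq: "\<And>s. 0 < s \<Longrightarrow> laplace_transform \<mu> s = laplace_transform \<nu> s"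
  shows "\<mu> = \<nu>"
proof -
  \<comment> \<open>The transforms are compared at positive arguments only; the zeroth moment is the
    total mass.\<close>
  have monomials: "(LINT x|\<mu>. exp (- x) ^ k) = (LINT x|\<nu>. exp (- x) ^ k)" for k :: nat
  proof (cases "k = 0")
    case True
    then show ?thesis
      using \<mu> \<nu> by (simp add: nonneg_distribution_def real_distribution_def prob_space.prob_space)
  next
    case False
    then show ?thesis
      using eq[of "real k"] by (simp add: laplace_transform_def flip: exp_of_nat_mult)
  qed
  have AE01: "AE x in \<rho>. exp (- x) \<in> {0..1}" if "nonneg_distribution \<rho>" for \<rho> :: "real measure"
  proof -
    have "AE x in \<rho>. 0 \<le> x" using that by (simp add: nonneg_distribution_def)
    then show ?thesis by eventually_elim simp
  qed
  have cont: "(LINT x|\<mu>. f (exp (- x))) = (LINT x|\<nu>. f (exp (- x)))"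
    if f: "continuous_on UNIV f" for f :: "real \<Rightarrow> real"
  proof (rule ccontr)
    assume neq: "(LINT x|\<mu>. f (exp (- x))) \<noteq> (LINT x|\<nu>. f (exp (- x)))"
    \<comment> \<open>Replacing \<open>f\<close> by a polynomial costs at most \<open>e\<close>
      under each law, so the two means would differ by at most \<open>2 * e\<close>, against the
      assumed \<open>3 * e\<close>.\<close>
    define e where "e = \<bar>(LINT x|\<mu>. f (exp (- x))) - (LINT x|\<nu>. f (exp (- x)))\<bar> / 3"
    have e: "e > 0" using neq by (simp add: e_def)
    have f01: "continuous_on {0..1} f" using f continuous_on_subset by blast
    then obtain p where p: "real_polynomial_function p" "\<And>y. y \<in> {0..1} \<Longrightarrow> \<bar>f y - p y\<bar> < e"
      using Stone_Weierstrass_real_polynomial_function[OF _ f01 e] by (metis compact_Icc)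
    then obtain a n where pa: "p = (\<lambda>y. \<Sum>i\<le>n. a i * y ^ i)"
      by (auto simp: real_polynomial_function_iff_sum)
    have close: "\<bar>(LINT x|\<rho>. f (exp (- x))) - (\<Sum>i\<le>n. a i * (LINT x|\<rho>. exp (- x) ^ i))\<bar> \<le> e"
      if \<rho>: "nonneg_distribution \<rho>" for \<rho>
    proof -
      interpret R: real_distribution \<rho> using \<rho> by (simp add: nonneg_distribution_def)
      have im: "integrable \<rho> (\<lambda>x. exp (- x) ^ i)" for i :: nat
      proof (rule R.integrable_const_bound[where B=1])
        show "AE x in \<rho>. norm (exp (- x) ^ i) \<le> 1"
          using AE01[OF \<rho>] by eventually_elim (simp add: power_le_one)
      qed measurable
      have ip: "integrable \<rho> (\<lambda>x. p (exp (- x)))"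
        unfolding pa by (intro Bochner_Integration.integrable_sum integrable_mult_right im)
      have fm: "(\<lambda>x. f (exp (- x))) \<in> borel_measurable \<rho>"
        by (rule measurable_compose[OF _ borel_measurable_continuous_onI[OF f]]) measurable
      have pm: "(\<lambda>x. p (exp (- x))) \<in> borel_measurable \<rho>" using ip by simp
      have bd: "AE x in \<rho>. norm (f (exp (- x)) - p (exp (- x))) \<le> e"
        using AE01[OF \<rho>] by eventually_elim (use p(2) in \<open>force intro: less_imp_le\<close>)
      have id: "integrable \<rho> (\<lambda>x. f (exp (- x)) - p (exp (- x)))"
        by (rule R.integrable_const_bound[OF bd]) (intro borel_measurable_diff fm pm)
      have "integrable \<rho> (\<lambda>x. f (exp (- x)))"
        using Bochner_Integration.integrable_add[OF id ip] by simp
      then have "(LINT x|\<rho>. f (exp (- x))) - (\<Sum>i\<le>n. a i * (LINT x|\<rho>. exp (- x) ^ i)) =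
          (LINT x|\<rho>. f (exp (- x)) - p (exp (- x)))"
        by (subst Bochner_Integration.integral_diff[OF _ ip]) (auto simp: pa Bochner_Integration.integral_sum im)
      also have "\<bar>\<dots>\<bar> \<le> (LINT x|\<rho>. norm (f (exp (- x)) - p (exp (- x))))"
        using integral_norm_bound[of \<rho> "\<lambda>x. f (exp (- x)) - p (exp (- x))"] by simp
      also have "\<dots> \<le> (LINT x|\<rho>. e)"
        by (intro integral_mono_AE integrable_norm id bd) simp
      finally show ?thesis by (simp add: R.prob_space[simplified])
    qed
    show False
    proof -
      have "\<bar>(LINT x|\<mu>. f (exp (- x))) - (LINT x|\<nu>. f (exp (- x)))\<bar> = 3 * e" by (simp add: e_def)
      with close[OF \<mu>] close[OF \<nu>] e show ?thesis unfolding monomials by linarith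
    qed
  qed
  interpret M: real_distribution \<mu> using \<mu> by (simp add: nonneg_distribution_def)
  interpret N: real_distribution \<nu> using \<nu> by (simp add: nonneg_distribution_def)
  have char_exp: "char (distr \<rho> borel (\<lambda>x. exp (- x))) u =
      Complex (LINT x|\<rho>. cos (u * exp (- x))) (LINT x|\<rho>. sin (u * exp (- x)))"
    if "real_distribution \<rho>" for \<rho> u
  proof -
    interpret R: real_distribution \<rho> by fact
    have int: "integrable \<rho> (\<lambda>x. iexp (u * exp (- x)))"
      by (intro R.integrable_const_bound[where B=1]) auto
    have "char (distr \<rho> borel (\<lambda>x. exp (- x))) u = (LINT x|\<rho>. iexp (u * exp (- x)))"
      unfolding char_def by (subst integral_distr) auto
    then show ?thesis
      using int by (simp add: complex_eq_iff Re_exp Im_exp flip: integral_Re integral_Im)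
  qed
  have "distr \<mu> borel (\<lambda>x. exp (- x)) = distr \<nu> borel (\<lambda>x. exp (- x))"
  proof (rule Levy_uniqueness)
    show "char (distr \<mu> borel (\<lambda>x. exp (- x))) = char (distr \<nu> borel (\<lambda>x. exp (- x)))"
      using cont[of "\<lambda>y. cos (_ * y)"] cont[of "\<lambda>y. sin (_ * y)"]
      by (auto simp: char_exp M.real_distribution_axioms N.real_distribution_axioms
            fun_eq_iff continuous_intros)
  qed (auto intro!: M.real_distribution_distr N.real_distribution_distr)
  \<comment> \<open>The map \<open>- ln y\<close> undoes the substitution at every real
    \<open>x\<close>, so both laws are recovered without exceptional sets.\<close>
  then have "distr (distr \<mu> borel (\<lambda>x. exp (- x))) borel (\<lambda>y. - ln y) =
      distr (distr \<nu> borel (\<lambda>x. exp (- x))) borel (\<lambda>y. - ln y)" by simp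
  then have "distr \<mu> borel (\<lambda>x. x) = distr \<nu> borel (\<lambda>x. x)"
    by (simp add: distr_distr comp_def)
  moreover have "distr \<mu> borel (\<lambda>x. x) = \<mu>" "distr \<nu> borel (\<lambda>x. x) = \<nu>"
    by (auto intro!: distr_id2)
  ultimately show ?thesis by simp
qed

text \<open>The factorization on the positive axis is first turned into an equality of laws, which
  then yields it on the whole closed half plane. No analytic continuation is involved.\<close>

lemma nonneg_selfdecomposable_laplace_mean:
  assumes \<mu>: "nonneg_selfdecomposable \<mu>" and c: "0 < c" "c < 1"
  obtains \<nu> where "nonneg_distribution \<nu>"
    and "\<And>z. 0 \<le> Re z \<Longrightarrow> laplace_mean \<mu> z = laplace_mean \<mu> (of_real c * z) * laplace_mean \<nu> z"
proof -
  obtain \<nu> where \<nu>: "nonneg_distribution \<nu>"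
    and lt: "\<And>s. s > 0 \<Longrightarrow> laplace_transform \<mu> s = laplace_transform \<mu> (c * s) * laplace_transform \<nu> s"
    using \<mu> c unfolding nonneg_selfdecomposable_def by metis
  have \<mu>': "nonneg_distribution \<mu>" using \<mu> by (simp add: nonneg_selfdecomposable_def)
  let ?D = "distr (\<mu> \<Otimes>\<^sub>M \<nu>) borel (\<lambda>p. c * fst p + snd p)"
  have D: "\<mu> = ?D"
  proof (rule laplace_transform_unique[OF \<mu>' nonneg_distribution_convolution[OF \<mu>' \<nu>]])
    fix s :: real assume s: "0 < s"
    have "complex_of_real (laplace_transform ?D s) = of_real (laplace_transform \<mu> (c * s) * laplace_transform \<nu> s)"
      using laplace_mean_convolution[OF \<mu>' \<nu>, of c "of_real s"] c s
      by (simp add: laplace_mean_of_real flip: of_real_mult)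
    then show "laplace_transform \<mu> s = laplace_transform ?D s"
      using lt[OF s] by (simp only: of_real_eq_iff)
  qed (use c in simp)
  have "laplace_mean \<mu> z = laplace_mean \<mu> (of_real c * z) * laplace_mean \<nu> z" if "0 \<le> Re z" for z
    using laplace_mean_convolution[OF \<mu>' \<nu> less_imp_le[OF c(1)] that] unfolding D[symmetric] .
  with \<nu> show ?thesis by (rule that)
qed


section \<open>The subordinated distribution\<close>

text \<open>
  The witness is the law of \<open>Y' V\<close> for a time \<open>V\<close> with law \<open>\<nu>\<close>, independent of \<open>Y'\<close>.
\<close>

lemma characteristic_function_laplace_mean:
  assumes L: "levy_process M Y" and \<psi>: "characteristic_exponent (char (distr M borel (Y 1))) \<psi>"
    and rcm: "right_continuous_modification M Y Y'" and \<nu>: "nonneg_distribution \<nu>"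
  shows "characteristic_function (\<lambda>u. laplace_mean \<nu> (\<psi> u))"
proof -
  interpret M: prob_space M using levy_process_prob_space[OF L] .
  interpret N: real_distribution \<nu> using \<nu> by (simp add: nonneg_distribution_def)
  interpret P: pair_prob_space M \<nu> ..
  have Y'm: "\<And>q. 0 \<le> q \<Longrightarrow> Y' q \<in> borel_measurable M"
    and Y'Y: "\<And>q. 0 \<le> q \<Longrightarrow> AE \<omega> in M. Y' q \<omega> = Y q \<omega>"
    and rc: "\<And>\<omega> q. \<omega> \<in> space M \<Longrightarrow> 0 \<le> q \<Longrightarrow> continuous (at_right q) (\<lambda>s. Y' s \<omega>)"
    using rcm by (auto simp: right_continuous_modification_def real_process_def)
  have Y0: "AE \<omega> in M. Y 0 \<omega> = 0" using L by (simp add: levy_process_def)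
  \<comment> \<open>The law \<open>\<nu>\<close> is carried by the half-line only up to a null set.
    Truncation by \<open>max 0\<close> makes the time nonnegative everywhere, as the measurability
    lemma requires, and changes \<open>Z\<close> on a null set only.\<close>
  define Z where "Z = (\<lambda>p. Y' (max 0 (snd p)) (fst p))"
  have Zm: "Z \<in> borel_measurable (M \<Otimes>\<^sub>M \<nu>)"
    unfolding Z_def
  proof (rule right_continuous_compose_measurable[where Z="\<lambda>q p. Y' q (fst p)" and V="\<lambda>p. max 0 (snd p)"])
    show "(\<lambda>p. Y' q (fst p)) \<in> borel_measurable (M \<Otimes>\<^sub>M \<nu>)" if "0 < q" for q
      using that by (intro measurable_compose[OF measurable_fst Y'm]) simp
    show "(\<lambda>p. max 0 (snd p)) \<in> borel_measurable (M \<Otimes>\<^sub>M \<nu>)" by measurable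
  qed (use rc in \<open>auto simp: space_pair_measure\<close>)
  define \<mu> where "\<mu> = distr (M \<Otimes>\<^sub>M \<nu>) borel Z"
  have "char \<mu> u = laplace_mean \<nu> (\<psi> u)" for u
  proof -
    have im: "(\<lambda>p. iexp (u * Z p)) \<in> borel_measurable (M \<Otimes>\<^sub>M \<nu>)"
      by (rule measurable_compose[OF Zm borel_measurable_iexp_mult])
    have int: "integrable (M \<Otimes>\<^sub>M \<nu>) (\<lambda>(\<omega>, v). iexp (u * Z (\<omega>, v)))"
      using im by (intro P.integrable_const_bound[where B=1]) (auto simp: case_prod_beta')
    have "char \<mu> u = (LINT p|(M \<Otimes>\<^sub>M \<nu>). iexp (u * Z p))"
      unfolding char_def \<mu>_def by (rule integral_distr[OF Zm borel_measurable_iexp_mult])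
    also have "\<dots> = (LINT v|\<nu>. LINT \<omega>|M. iexp (u * Z (\<omega>, v)))"
      using P.integral_snd[OF int] by (simp add: case_prod_beta')
    also have "\<dots> = laplace_mean \<nu> (\<psi> u)"
      unfolding laplace_mean_def
    proof (rule integral_cong_AE)
      show "(\<lambda>v. LINT \<omega>|M. iexp (u * Z (\<omega>, v))) \<in> borel_measurable \<nu>"
        using P.integrable_snd[OF int] by simp
      have "(\<lambda>x. exp (- (\<psi> u * of_real x))) \<in> borel_measurable borel"
        by (intro borel_measurable_continuous_onI continuous_intros)
      then show "(\<lambda>x. exp (- (\<psi> u * of_real x))) \<in> borel_measurable \<nu>" by simp
      \<comment> \<open>At a fixed time \<open>v\<close> the modification agrees with
        \<open>Y\<close> almost surely, so the inner mean is that of an increment of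
        \<open>Y\<close>.\<close>
      have "(LINT \<omega>|M. iexp (u * Z (\<omega>, v))) = exp (- (\<psi> u * of_real v))" if v: "0 \<le> v" for v
      proof -
        have "(LINT \<omega>|M. iexp (u * Z (\<omega>, v))) = increment_mean M Y (\<lambda>x. iexp (u * x)) v"
          unfolding increment_mean_def
        proof (rule integral_cong_AE)
          show "(\<lambda>\<omega>. iexp (u * Z (\<omega>, v))) \<in> borel_measurable M"
            using measurable_compose[OF Y'm[OF v] borel_measurable_iexp_mult] v by (simp add: Z_def)
          have "(\<lambda>\<omega>. Y v \<omega> - Y 0 \<omega>) \<in> borel_measurable M"
            using levy_process_measurable[OF L] v by (intro borel_measurable_diff) auto
          then show "(\<lambda>\<omega>. iexp (u * (Y v \<omega> - Y 0 \<omega>))) \<in> borel_measurable M"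
            by (rule measurable_compose[OF _ borel_measurable_iexp_mult])
          show "AE \<omega> in M. iexp (u * Z (\<omega>, v)) = iexp (u * (Y v \<omega> - Y 0 \<omega>))"
            using Y'Y[OF v] Y0 by eventually_elim (use v in \<open>simp add: Z_def\<close>)
        qed
        then show ?thesis using increment_mean_iexp_eq_exp[OF L \<psi> v] by simp
      qed
      moreover have "AE v in \<nu>. 0 \<le> v" using \<nu> by (simp add: nonneg_distribution_def)
      ultimately show "AE v in \<nu>. (LINT \<omega>|M. iexp (u * Z (\<omega>, v))) = exp (- (\<psi> u * of_real v))"
        by auto
    qed
    finally show ?thesis .
  qed
  moreover have "real_distribution \<mu>"
    unfolding \<mu>_def by (rule P.real_distribution_distr[OF Zm])
  ultimately show ?thesis
    unfolding characteristic_function_def by (intro exI[of _ \<mu>]) auto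
qed

lemma subordinated_char:
  assumes S: "subordinated N X M Y T" and \<psi>: "characteristic_exponent (char (distr M borel (Y 1))) \<psi>"
  shows "char (distr N borel (X 1)) u = laplace_mean (distr M borel (T 1)) (\<psi> u)"
proof -
  have Y: "levy_process M Y" and P: "positive_levy_process M T" and T: "levy_process M T"
    and rp: "real_process N X"
    using S by (auto simp: subordinated_def positive_levy_process_def)
  have Xm: "X r \<in> borel_measurable N" if "0 \<le> r" for r using rp that by (simp add: real_process_def)
  have Tm: "T r \<in> borel_measurable M" if "0 \<le> r" for r using levy_process_measurable[OF T that] .
  have expm: "(\<lambda>x. exp (- (\<psi> u * of_real x))) \<in> borel_measurable borel"
    by (intro borel_measurable_continuous_onI continuous_intros)
  have "char (distr N borel (X 1)) u = char (distr N borel (\<lambda>\<omega>. X 1 \<omega> - X 0 \<omega>)) u"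
  proof -
    have "distr N borel (X 1) = distr N borel (\<lambda>\<omega>. X 1 \<omega> - X 0 \<omega>)"
      using subordinated_start[OF S] Xm[of 0] Xm[of 1] by (intro distr_cong_AE) auto
    then show ?thesis by simp
  qed
  also have "\<dots> = (LINT \<omega>|N. iexp (u * (X 1 \<omega> - X 0 \<omega>)))"
    by (rule char_distr_increment[OF rp]) auto
  also have "\<dots> = increment_mean M T (\<lambda>x. increment_mean M Y (\<lambda>x. iexp (u * x)) \<bar>x\<bar>) 1"
    using subordinated_mean[OF S _ _ iexp_mult_uniformly_continuous[of u], of 0 1 1] by simp
  also have "\<dots> = (LINT \<omega>|M. exp (- (\<psi> u * of_real \<bar>T 1 \<omega> - T 0 \<omega>\<bar>)))"
    unfolding increment_mean_iexp_eq_exp[OF Y \<psi> abs_ge_zero] increment_mean_def[of M T] ..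
  \<comment> \<open>The absolute value left by the extension to the whole line disappears:
    \<open>T 1\<close> is nonnegative and \<open>T 0\<close> is almost surely 0.\<close>
  also have "\<dots> = (LINT \<omega>|M. exp (- (\<psi> u * of_real (T 1 \<omega>))))"
  proof (rule integral_cong_AE)
    have "(\<lambda>\<omega>. \<bar>T 1 \<omega> - T 0 \<omega>\<bar>) \<in> borel_measurable M"
      using Tm by (intro borel_measurable_abs borel_measurable_diff) auto
    then show "(\<lambda>\<omega>. exp (- (\<psi> u * of_real \<bar>T 1 \<omega> - T 0 \<omega>\<bar>))) \<in> borel_measurable M"
      by (rule measurable_compose[OF _ expm])
    show "(\<lambda>\<omega>. exp (- (\<psi> u * of_real (T 1 \<omega>)))) \<in> borel_measurable M"
      by (rule measurable_compose[OF Tm expm]) simp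
    have "AE \<omega> in M. T 0 \<omega> = 0" using T by (simp add: levy_process_def)
    then show "AE \<omega> in M. exp (- (\<psi> u * of_real \<bar>T 1 \<omega> - T 0 \<omega>\<bar>)) = exp (- (\<psi> u * of_real (T 1 \<omega>)))"
      using AE_space by eventually_elim (use P in \<open>simp add: positive_levy_process_def\<close>)
  qed
  also have "\<dots> = laplace_mean (distr M borel (T 1)) (\<psi> u)"
    unfolding laplace_mean_def by (rule integral_distr[OF Tm expm, symmetric]) simp
  finally show ?thesis .
qed

theorem mainTheorem4:
  fixes a b :: real
    and M :: "'w measure" and Y T :: "real \<Rightarrow> 'w \<Rightarrow> real"
    and N :: "'v measure" and X :: "real \<Rightarrow> 'v \<Rightarrow> real"
  assumes "0 < b" and "b < 1" and "1 < a"
    and "semi_stable_process a b M Y"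
    and "positive_selfdecomposable_process M T"
    and "independent_processes M Y T"
    and "subordinated N X M Y T"
  shows "semi_selfdecomposable_process b N X"
proof -
  note S = \<open>subordinated N X M Y T\<close>
  have Y: "levy_process M Y" using S by (simp add: subordinated_def)
  obtain Y' where rcm: "right_continuous_modification M Y Y'" using S by (auto simp: subordinated_def)
  obtain \<psi> where \<psi>: "characteristic_exponent (char (distr M borel (Y 1))) \<psi>"
    and stable: "\<And>u. \<psi> u = of_real a * \<psi> (b * u)"
    using \<open>semi_stable_process a b M Y\<close> unfolding semi_stable_process_def semi_stable_def by blast
  have "nonneg_selfdecomposable (distr M borel (T 1))"
    using \<open>positive_selfdecomposable_process M T\<close> by (simp add: positive_selfdecomposable_process_def)
  \<comment> \<open>Selfdecomposability offers every factor in (0,1); \<open>1 / a\<close> is the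
    one that semi-stability converts into scaling of the argument by \<open>b\<close>.\<close>
  then obtain \<nu> where \<nu>: "nonneg_distribution \<nu>"
    and split: "\<And>z. 0 \<le> Re z \<Longrightarrow> laplace_mean (distr M borel (T 1)) z =
      laplace_mean (distr M borel (T 1)) (of_real (1 / a) * z) * laplace_mean \<nu> z"
    using nonneg_selfdecomposable_laplace_mean[of "distr M borel (T 1)" "1 / a"] \<open>1 < a\<close> by auto
  let ?f = "char (distr N borel (X 1))"
  have "?f s = ?f (b * s) * laplace_mean \<nu> (\<psi> s)" for s
  proof -
    have "of_real (1 / a) * \<psi> s = \<psi> (b * s)"
      using stable[of s] \<open>1 < a\<close> by simp
    then show ?thesis
      unfolding subordinated_char[OF S \<psi>]
      using split[OF characteristic_exponent_Re_nonneg[OF Y \<psi>]] by simp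
  qed
  moreover have "characteristic_function ?f"
    unfolding characteristic_function_def
    using S by (intro exI[of _ "distr N borel (X 1)"])
      (auto simp: subordinated_def real_process_def intro!: prob_space.real_distribution_distr)
  moreover note characteristic_function_laplace_mean[OF Y \<psi> rcm \<nu>]
  ultimately have "semi_selfdecomposable b ?f"
    unfolding semi_selfdecomposable_def using \<open>0 < b\<close> \<open>b < 1\<close> by blast
  then show ?thesis
    unfolding semi_selfdecomposable_process_def using subordinated_levy_process[OF S] by simp
qed

end
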